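(* Let $i_0,j_0$ be positive integers and let $t_{i,j}$ ($1\le i\le i_0$, $0\le j\le j_0$) be real numbers such that $\hat t_i:=\sum_{j=0}^{j_0}t_{i,j}\ge0$ for all $i$. Suppose the polynomial $T(x)=x^{i_0}-\sum_{i=1}^{i_0}\hat t_i x^{i_0-i}$ has the maximum root property with some maximum root $\lambda_1$. Let $n_0$ be an integer and let $(p_{n,k})_{n,k\in\mathbb{Z}}$ be real numbers satisfying, for all $n\ge n_0$ and all $k$, \[p_{n,k}=\sum_{i=1}^{i_0}\sum_{j=0}^{j_0}t_{i,j}\,p_{n-i,k-j}.\] Suppose further that $p_{n,k}\ge0$ for all $n,k$; $p_{n,k}=0$ whenever $n<0$ or $k<0$; only finitely many $p_{n,k}$ with $n<n_0$ are nonzero; and $\Omega_n:=\sum_{k\ge0}p_{n,k}=\Theta(\lambda_1^n)$. Let $X_n$ be the random variable with $\Pr[X_n=k]=p_{n,k}/\Omega_n$, with mean $\mu_n$ and variance $\sigma_n^2$. Define \[C_\mu=\frac{\sum_{i=1}^{i_0}\sum_{j=0}^{j_0}\frac{t_{i,j}\,j}{\lambda_1^i}}{\sum_{i=1}^{i_0}\sum_{j=0}^{j_0}\frac{t_{i,j}\,i}{\lambda_1^i}},\qquad C_\sigma=\frac{\sum_{i=1}^{i_0}\sum_{j=0}^{j_0}\frac{t_{i,j}}{\lambda_1^i}(j-C_\mu i)^2}{\sum_{i=1}^{i_0}\sum_{j=0}^{j_0}\frac{t_{i,j}\,i}{\lambda_1^i}},\] and assume $C_\sigma>0$. Then there exist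 constants $d_\mu,d_\sigma\in\mathbb{R}$ and $\gamma_\mu,\gamma_\sigma\in(0,1)$ such that $\mu_n=C_\mu n+d_\mu+O(\gamma_\mu^n)$ and $\sigma_n^2=C_\sigma n+d_\sigma+O(\gamma_\sigma^n)$. Furthermore, $(X_n-\mu_n)/\sigma_n$ converges weakly to the standard normal distribution $N(0,1)$ as $n\to\infty$.
   Context: For a real number $\lambda_1>0$, a polynomial $A(x)$ has the maximum root property with maximum root $\lambda_1$ if $\lambda_1$ is a root of $A$ of multiplicity one and all other (complex) roots of $A$ have absolute value strictly less than $\lambda_1$. Big-$O$ and $\Theta$ are as $n\to\infty$. *)

theory Defs
  imports
    "HOL-Probability.Probability"
    "HOL-Computational_Algebra.Polynomial"
    "HOL-Library.Landau_Symbols"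
begin

definition has_maximum_root :: "real poly \<Rightarrow> real \<Rightarrow> bool" where
  "has_maximum_root A r \<longleftrightarrow>
     r > 0 \<and> poly A r = 0 \<and> order r A = 1 \<and>
     (\<forall>z::complex. poly (map_poly of_real A) z = 0 \<and> z \<noteq> of_real r \<longrightarrow> norm z < r)"

definition t_hat :: "nat \<Rightarrow> (nat \<Rightarrow> nat \<Rightarrow> real) \<Rightarrow> nat \<Rightarrow> real" where
  "t_hat j0 t i = (\<Sum>j=0..j0. t i j)"

definition T_poly :: "nat \<Rightarrow> nat \<Rightarrow> (nat \<Rightarrow> nat \<Rightarrow> real) \<Rightarrow> real poly" where
  "T_poly i0 j0 t = monom 1 i0 - (\<Sum>i=1..i0. monom (t_hat j0 t i) (i0 - i))"

definition Omega :: "(int \<Rightarrow> int \<Rightarrow> real) \<Rightarrow> nat \<Rightarrow> real" where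
  "Omega p n = (\<Sum>\<^sub>\<infinity>k\<in>{0..}. p (int n) k)"

definition C_mu :: "nat \<Rightarrow> nat \<Rightarrow> (nat \<Rightarrow> nat \<Rightarrow> real) \<Rightarrow> real \<Rightarrow> real" where
  "C_mu i0 j0 t l =
     (\<Sum>i=1..i0. \<Sum>j=0..j0. t i j * real j / l ^ i) /
     (\<Sum>i=1..i0. \<Sum>j=0..j0. t i j * real i / l ^ i)"

definition C_sigma :: "nat \<Rightarrow> nat \<Rightarrow> (nat \<Rightarrow> nat \<Rightarrow> real) \<Rightarrow> real \<Rightarrow> real" where
  "C_sigma i0 j0 t l =
     (\<Sum>i=1..i0. \<Sum>j=0..j0. t i j / l ^ i * (real j - C_mu i0 j0 t l * real i)\<^sup>2) /
     (\<Sum>i=1..i0. \<Sum>j=0..j0. t i j * real i / l ^ i)"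

end

theory Submission
  imports Defs "HOL-Complex_Analysis.Complex_Analysis" "HOL-Real_Asymp.Real_Asymp"
begin

text \<open>
  Put \<open>F\<^sub>n(s) = \<Sum>\<^sub>k p\<^sub>n\<^sub>,\<^sub>k e\<^bsup>ks\<^esup>\<close>, the moment generating function of \<open>X\<^sub>n\<close> up to the factor
  \<open>\<Omega>\<^sub>n = F\<^sub>n(0)\<close>. For fixed \<open>s\<close> it satisfies a linear recurrence whose characteristic polynomial at
  \<open>s = 0\<close> is \<open>T\<close>. The implicit function theorem for \<open>\<Sum> t\<^sub>i\<^sub>,\<^sub>j e\<^bsup>js - iL(s)\<^esup> = 1\<close> continues the dominant
  root to \<open>e\<^bsup>L(s)\<^esup>\<close> with \<open>L\<close> holomorphic near \<open>0\<close> and \<open>L(0) = ln \<lambda>\<^sub>1\<close>; differentiating the equation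
  twice at \<open>0\<close> gives \<open>L'(0) = C\<^sub>\<mu>\<close> and \<open>L''(0) = C\<^sub>\<sigma>\<close>. Removing the dominant root from the recurrence
  leaves one whose generating function has a denominator without zeros in a disc of radius larger
  than \<open>1/\<lambda>\<^sub>1\<close>, uniformly in \<open>s\<close>, so by Cauchy's inequality \<open>u\<^sub>n(s) = F\<^sub>n(s) e\<^bsup>-nL(s)\<^esup>\<close> has uniformly
  geometrically small increments. Hence \<open>u\<^sub>n\<close> and its derivatives at \<open>0\<close> converge geometrically.
  The logarithmic derivatives of \<open>F\<^sub>n = e\<^bsup>nL\<^esup> u\<^sub>n\<close> at \<open>0\<close> are the mean and the variance, and its values at
  \<open>i\<theta>/\<sigma>\<^sub>n\<close> give the characteristic functions for Levy's continuity theorem.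
\<close>

section \<open>An implicit function theorem\<close>

text \<open>The inverse function theorem is applied to \<open>(s, w) |-> (s, H (s, w))\<close>,
  whose derivative is triangular and invertible where \<open>Hw\<close> is nonzero. Following the
  inverse along the line with second coordinate \<open>H (s0, w0)\<close> gives \<open>L\<close>.
  Its real derivative is multiplication by the complex number \<open>- Hs / Hw\<close>, so
  \<open>L\<close> is holomorphic.\<close>

lemma complex_implicit_function:
  fixes H Hs Hw :: "complex \<times> complex \<Rightarrow> complex"
  assumes der: "\<And>x. (H has_derivative (\<lambda>v. Hs x * fst v + Hw x * snd v)) (at x)"
    and cont: "continuous_on UNIV Hs" "continuous_on UNIV Hw"
    and nz: "Hw (s0, w0) \<noteq> 0"
  obtains \<delta> L where "\<delta> > 0" "L holomorphic_on ball s0 \<delta>" "L s0 = w0"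
    "\<And>s. s \<in> ball s0 \<delta> \<Longrightarrow> H (s, L s) = H (s0, w0)"
proof -
  define inl inr :: "complex \<Rightarrow>\<^sub>L (complex \<times> complex)"
    where "inl = Blinfun (\<lambda>a. (a, 0))" and "inr = Blinfun (\<lambda>b. (0, b))"
  have inl: "blinfun_apply inl a = (a, 0)" and inr: "blinfun_apply inr a = (0, a)" for a
    unfolding inl_def inr_def
    by (subst bounded_linear_Blinfun_apply; auto intro!: bounded_linear_intros)+
  \<comment> \<open>\<open>P a b\<close> is the matrix with rows (1, 0) and (a, b). Assembling it
    from bounded linear operators makes its continuity in \<open>a\<close> and \<open>b\<close>
    immediate.\<close>
  define P where "P a b = (inl o\<^sub>L fst_blinfun)
      + (inr o\<^sub>L ((blinfun_mult_right a o\<^sub>L fst_blinfun) + (blinfun_mult_right b o\<^sub>L snd_blinfun)))"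
    for a b :: complex
  have P: "blinfun_apply (P a b) v = (fst v, a * fst v + b * snd v)" for a b v
    by (simp add: P_def inl inr blinfun.add_left)
  define f where "f x = (fst x, H x)" for x
  define f' where "f' x = P (Hs x) (Hw x)" for x
  have d1: "(f has_derivative blinfun_apply (f' x)) (at x)" for x
    unfolding f_def f'_def P by (auto intro!: derivative_eq_intros der)
  have d2: "continuous_on UNIV f'"
    unfolding f'_def P_def by (intro continuous_intros cont)
  \<comment> \<open>The inverse of the triangular matrix with rows (1, 0) and (Hs, Hw).\<close>
  have d3: "P (- Hs (s0, w0) / Hw (s0, w0)) (1 / Hw (s0, w0)) o\<^sub>L f' (s0, w0) = id_blinfun"
    by (rule blinfun_eqI) (simp add: f'_def P nz prod_eq_iff field_simps)
  obtain U' V g g' where "open U'" "U' \<subseteq> UNIV" and U': "(s0, w0) \<in> U'"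
    and V: "open V" "f (s0, w0) \<in> V" and hom: "homeomorphism U' V f g"
    and g: "\<And>y. y \<in> V \<Longrightarrow> (g has_derivative (g' y)) (at y)"
      "\<And>y. y \<in> V \<Longrightarrow> g' y = inv (blinfun_apply (f' (g y)))"
    and bij: "\<And>y. y \<in> V \<Longrightarrow> bij (blinfun_apply (f' (g y)))"
    by (rule inverse_function_theorem[OF open_UNIV d1 d2 UNIV_I d3], rule that)
  define c where "c = H (s0, w0)"
  have "open ((\<lambda>s. (s, c)) -` V)"
    by (rule continuous_open_vimage) (auto intro!: continuous_intros V)
  moreover have "s0 \<in> (\<lambda>s. (s, c)) -` V"
    using V by (simp add: f_def c_def)
  ultimately obtain \<delta> where \<delta>: "\<delta> > 0" "ball s0 \<delta> \<subseteq> (\<lambda>s. (s, c)) -` V"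
    by (meson open_contains_ball)
  define L where "L s = snd (g (s, c))" for s
  have inV: "(s, c) \<in> V" if "s \<in> ball s0 \<delta>" for s
    using \<delta> that by auto
  have fg: "f (g (s, c)) = (s, c)" if "s \<in> ball s0 \<delta>" for s
    using hom inV[OF that] by (simp add: homeomorphism_def)
  have gL: "g (s, c) = (s, L s)" if "s \<in> ball s0 \<delta>" for s
    using fg[OF that] by (simp add: f_def L_def prod_eq_iff)
  show thesis
  proof
    show "\<delta> > 0" by fact
    have "g (s0, c) = (s0, w0)"
      using homeomorphism_apply1[OF hom U'] by (simp add: f_def c_def)
    then show "L s0 = w0" by (simp add: L_def)
    show "H (s, L s) = H (s0, w0)" if "s \<in> ball s0 \<delta>" for s
      using fg[OF that] gL[OF that] by (simp add: f_def c_def)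
    have "(L has_field_derivative - Hs (s, L s) / Hw (s, L s)) (at s)" if s: "s \<in> ball s0 \<delta>" for s
    proof -
      note V' = inV[OF s]
      let ?A = "blinfun_apply (f' (g (s, c)))"
      \<comment> \<open>The derivative is a bijection, whereas \<open>Hw (s, L s) = 0\<close> would
        send (0, 1) to 0.\<close>
      have "?A (0, 1) \<noteq> ?A (0, 0)"
        using bij[OF V'] by (metis bij_pointE prod.inject zero_neq_one)
      then have nz: "Hw (s, L s) \<noteq> 0"
        by (simp add: f'_def P gL[OF s])
      have "(L has_derivative (\<lambda>h. snd (g' (s, c) (h, 0)))) (at s)"
        unfolding L_def
        by (rule has_derivative_snd, rule has_derivative_compose[of "\<lambda>s. (s, c)" _ _ _ g, OF _ g(1)[OF V']])
           (auto intro!: derivative_eq_intros)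
      moreover have "snd (g' (s, c) (h, 0)) = - Hs (s, L s) / Hw (s, L s) * h" for h
      proof -
        have "?A (g' (s, c) (h, 0)) = (h, 0)"
          by (simp add: g(2)[OF V'] bij_is_surj[OF bij[OF V']] surj_f_inv_f)
        then show ?thesis
          using nz by (auto simp: f'_def P gL[OF s] field_simps eq_neg_iff_add_eq_0)
      qed
      ultimately show ?thesis
        by (simp only: has_field_derivative_def)
    qed
    then show "L holomorphic_on ball s0 \<delta>"
      by (metis field_differentiable_at_within field_differentiable_def holomorphic_on_def)
  qed
qed

text \<open>The constant sum in \<open>eq\<close> has vanishing first and second derivatives. At 0
  these are linear equations for \<open>deriv L 0\<close> and, once that is known, for
  \<open>deriv (deriv L) 0\<close>.\<close>

lemma implicit_exponent_derivs:
  fixes c x y :: "'i \<Rightarrow> complex"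
  assumes S: "open S" "0 \<in> S" and L: "L holomorphic_on S"
    and eq: "\<And>s. s \<in> S \<Longrightarrow> (\<Sum>q\<in>I. c q * exp (x q * s - y q * L s)) = k"
  shows "(\<Sum>q\<in>I. c q * exp (- y q * L 0) * (x q - y q * deriv L 0)) = 0"
    and "(\<Sum>q\<in>I. c q * exp (- y q * L 0) * ((x q - y q * deriv L 0)\<^sup>2 - y q * deriv (deriv L) 0)) = 0"
proof -
  have D: "(L has_field_derivative deriv L s) (at s)"
    "(deriv L has_field_derivative deriv (deriv L) s) (at s)" if "s \<in> S" for s
    using that S(1) L by (auto intro: holomorphic_derivI holomorphic_deriv)
  have const: "f' = 0" if "(f has_field_derivative f') (at s)" "s \<in> S" "\<And>s. s \<in> S \<Longrightarrow> f s = b"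
    for f :: "complex \<Rightarrow> complex" and f' s b
  proof -
    have "((\<lambda>_. b) has_field_derivative f') (at s)"
      using that S(1) by (auto intro: has_field_derivative_transform_within_open)
    then show ?thesis
      using DERIV_const DERIV_unique by blast
  qed
  define G where "G s = (\<Sum>q\<in>I. c q * exp (x q * s - y q * L s) * (x q - y q * deriv L s))" for s
  have G: "G s = 0" if s: "s \<in> S" for s
  proof (rule const[OF _ s eq])
    show "((\<lambda>s. \<Sum>q\<in>I. c q * exp (x q * s - y q * L s)) has_field_derivative G s) (at s)"
      unfolding G_def by (rule DERIV_sum) (auto intro!: derivative_eq_intros D[OF s])
  qed
  from G[OF S(2)] show "(\<Sum>q\<in>I. c q * exp (- y q * L 0) * (x q - y q * deriv L 0)) = 0"
    by (simp add: G_def)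
  show "(\<Sum>q\<in>I. c q * exp (- y q * L 0) * ((x q - y q * deriv L 0)\<^sup>2 - y q * deriv (deriv L) 0)) = 0"
  proof (rule const[OF _ S(2) G])
    show "(G has_field_derivative
        (\<Sum>q\<in>I. c q * exp (- y q * L 0) * ((x q - y q * deriv L 0)\<^sup>2 - y q * deriv (deriv L) 0))) (at 0)"
      unfolding G_def
      by (rule DERIV_sum)
         (auto intro!: derivative_eq_intros D[OF S(2)] simp: algebra_simps power2_eq_square)
  qed
qed

section \<open>Linear recurrences with a dominant root\<close>

text \<open>\<open>G\<close> is the Taylor series at 0 of the rational function
  \<open>N / B\<close>, which is analytic in the disc of radius \<open>R\<close> and bounded by
  \<open>C / \<epsilon>\<close> on its boundary circle, so Cauchy's inequality applies.\<close>

lemma norm_fps_quotient_nth_le: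
  fixes B N :: "complex poly" and G :: "complex fps"
  assumes eq: "fps_of_poly B * G = fps_of_poly N"
    and R: "R > 0" and \<epsilon>: "\<epsilon> > 0"
    and B: "\<And>x. norm x \<le> R \<Longrightarrow> norm (poly B x) \<ge> \<epsilon>"
    and N: "\<And>x. norm x \<le> R \<Longrightarrow> norm (poly N x) \<le> C"
  shows "norm (fps_nth G n) \<le> C / \<epsilon> / R ^ n"
proof -
  define h where "h x = poly N x / poly B x" for x
  have nz: "poly B x \<noteq> 0" if "norm x \<le> R" for x
    using B[OF that] \<epsilon> by auto
  have hol: "h holomorphic_on ball 0 R"
    unfolding h_def using nz by (intro holomorphic_intros) auto
  have cont: "continuous_on (cball 0 R) h"
    unfolding h_def using nz by (intro continuous_intros) auto
  have "h has_fps_expansion fps_expansion h 0"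
    using hol R by (intro has_fps_expansion_fps_expansion[of "ball 0 R"]) auto
  moreover have PE: "poly P has_fps_expansion fps_of_poly P" for P :: "complex poly"
    by (auto simp: has_fps_expansion_def eval_fps_of_poly)
  ultimately have "(\<lambda>x. poly B x * h x) has_fps_expansion fps_of_poly B * fps_expansion h 0"
    by (intro has_fps_expansion_mult)
  moreover have "eventually (\<lambda>x. poly B x * h x = poly N x) (nhds 0)"
    using eventually_nhds_in_open[of "ball (0::complex) R" 0] R
    by (auto elim!: eventually_mono simp: h_def nz)
  then have "(\<lambda>x. poly B x * h x) has_fps_expansion fps_of_poly N"
    using has_fps_expansion_cong[OF _ refl] PE by metis
  ultimately have "fps_of_poly B * fps_expansion h 0 = fps_of_poly B * G"
    using fps_expansion_unique_complex eq by metis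
  moreover have "fps_of_poly B \<noteq> 0"
    using nz[of 0] R by auto
  ultimately have "G = fps_expansion h 0"
    by simp
  then have "fps_nth G n = (deriv ^^ n) h 0 / fact n"
    by (simp add: fps_expansion_def)
  moreover have "norm ((deriv ^^ n) h 0) \<le> fact n * (C / \<epsilon>) / R ^ n"
  proof (rule Cauchy_inequality[OF hol cont R])
    fix x :: complex assume "norm (0 - x) = R"
    then have x: "norm x \<le> R" by simp
    show "norm (h x) \<le> C / \<epsilon>"
      unfolding h_def norm_divide using B[OF x] N[OF x] \<epsilon>
      by (intro frac_le) (auto intro: order_trans[OF norm_ge_zero])
  qed
  ultimately show ?thesis
    by (simp add: norm_divide pos_divide_le_eq mult_ac)
qed

text \<open>
  The coefficients of the quotient of \<open>1 - \<Sum>\<^sub>i a\<^sub>i x\<^sup>i\<close> by \<open>1 - l x\<close>, when \<open>1 / l\<close> is a root.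
\<close>

definition deflate :: "(nat \<Rightarrow> complex) \<Rightarrow> complex \<Rightarrow> nat \<Rightarrow> complex" where
  "deflate a l i = l ^ i - (\<Sum>k=1..i. a k * l ^ (i - k))"

lemma deflate_0 [simp]: "deflate a l 0 = 1"
  by (simp add: deflate_def)

lemma deflate_Suc: "deflate a l (Suc i) = l * deflate a l i - a (Suc i)"
  by (simp add: deflate_def sum_distrib_left algebra_simps Suc_diff_le)

text \<open>Synthetic division: \<open>deflate_Suc\<close> is Horner's step, and the remainder
  \<open>deflate a l d\<close> vanishes by \<open>root\<close>.\<close>

lemma deflate_poly:
  assumes "d > 0" and l: "l \<noteq> 0" and root: "(\<Sum>i=1..d. a i / l ^ i) = 1"
  shows "1 - (\<Sum>i=1..d. monom (a i) i) = [:1, - l:] * (\<Sum>i<d. monom (deflate a l i) i)"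
proof (rule poly_eqI)
  fix n
  have "deflate a l d = l ^ d * (1 - (\<Sum>i=1..d. a i / l ^ i))"
    using l by (simp add: deflate_def algebra_simps sum_distrib_left power_diff)
  then have d0: "deflate a l d = 0"
    using root by simp
  have *: "coeff (\<Sum>i\<in>S. monom (f i) i) n = (if n \<in> S then f n else 0)"
    if "finite S" for S and f :: "nat \<Rightarrow> complex" and n
    using that by (simp add: coeff_sum)
  show "coeff (1 - (\<Sum>i=1..d. monom (a i) i)) n
      = coeff ([:1, - l:] * (\<Sum>i<d. monom (deflate a l i) i)) n"
  proof (cases n)
    case 0
    then show ?thesis using \<open>d > 0\<close> by (simp add: *)
  next
    case (Suc k)
    consider "n < d" | "n = d" | "n > d" by linarith
    then show ?thesis
      using deflate_Suc[of a l k] d0 by cases (auto simp: * Suc coeff_pCons)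
  qed
qed

text \<open>As the recurrence holds from \<open>m\<close> on, the generating function satisfies
  \<open>D * F = N\<close> with a polynomial \<open>N\<close> of degree below \<open>m\<close>.
  Moving the factor \<open>1 - l x\<close> of \<open>D\<close> over to the series gives
  \<open>Bp * G = N\<close>, where \<open>G\<close> has the coefficient
  \<open>F (Suc n) - l * F n\<close> at \<open>Suc n\<close>.\<close>

lemma deflated_recurrence_bound:
  fixes a F :: "nat \<Rightarrow> complex" and d :: nat
  defines "rhs \<equiv> \<lambda>n. \<Sum>i=1..d. a i * (if i \<le> n then F (n - i) else 0)"
  assumes d: "d > 0" and l: "l \<noteq> 0" and root: "(\<Sum>i=1..d. a i / l ^ i) = 1"
    and rec: "\<And>n. n \<ge> m \<Longrightarrow> F n = rhs n"
    and R: "R > 0" and \<epsilon>: "\<epsilon> > 0"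
    and B: "\<And>x. norm x \<le> R \<Longrightarrow> norm (\<Sum>i<d. deflate a l i * x ^ i) \<ge> \<epsilon>"
    and C: "(\<Sum>n<m. norm (F n - rhs n) * R ^ n) \<le> C"
  shows "norm (F (Suc n) - l * F n) \<le> C / \<epsilon> / R ^ Suc n"
proof -
  define N where "N = (\<Sum>n<m. monom (F n - rhs n) n)"
  define D where "D = 1 - (\<Sum>i=1..d. monom (a i) i)"
  define Bp where "Bp = (\<Sum>i<d. monom (deflate a l i) i)"
  define G where "G = fps_of_poly [:1, - l:] * Abs_fps F"
  have D: "D = [:1, - l:] * Bp"
    unfolding D_def Bp_def by (rule deflate_poly[OF d l root])
  have "fps_of_poly D * Abs_fps F = fps_of_poly N"
  proof (rule fps_ext)
    fix n
    have "fps_of_poly D * Abs_fps F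
        = Abs_fps F - (\<Sum>i=1..d. fps_const (a i) * (fps_X ^ i * Abs_fps F))"
      by (simp add: D_def fps_of_poly_diff fps_of_poly_sum fps_of_poly_monom left_diff_distrib
          sum_distrib_right mult.assoc)
    then have "fps_nth (fps_of_poly D * Abs_fps F) n = F n - rhs n"
      by (auto simp: rhs_def fps_sum_nth fps_X_power_mult_nth intro!: sum.cong)
    also have "\<dots> = (if n < m then F n - rhs n else 0)"
      using rec[of n] by auto
    also have "\<dots> = fps_nth (fps_of_poly N) n"
      by (simp add: N_def coeff_sum)
    finally show "fps_nth (fps_of_poly D * Abs_fps F) n = fps_nth (fps_of_poly N) n" .
  qed
  then have "fps_of_poly Bp * G = fps_of_poly N"
    by (simp only: D G_def fps_of_poly_mult mult_ac)
  moreover have "norm (poly N x) \<le> C" if "norm x \<le> R" for x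
  proof -
    have "norm (poly N x) \<le> (\<Sum>n<m. norm (F n - rhs n) * norm x ^ n)"
      by (auto simp: N_def poly_sum poly_monom norm_mult norm_power intro!: sum_norm_le)
    also have "\<dots> \<le> (\<Sum>n<m. norm (F n - rhs n) * R ^ n)"
      using that by (intro sum_mono mult_left_mono power_mono) auto
    finally show ?thesis using C by simp
  qed
  moreover have "norm (poly Bp x) \<ge> \<epsilon>" if "norm x \<le> R" for x
    using B[OF that] by (simp add: Bp_def poly_sum poly_monom)
  ultimately have "norm (fps_nth G (Suc n)) \<le> C / \<epsilon> / R ^ Suc n"
    using R \<epsilon> by (intro norm_fps_quotient_nth_le)
  then show ?thesis
    by (simp add: G_def fps_of_poly_pCons algebra_simps)
qed

text \<open>A zero \<open>x\<close> in this disc would give a root \<open>1 / x\<close> of the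
  characteristic polynomial of modulus at least \<open>l\<close>, so \<open>1 / x = l\<close> by
  dominance. This is impossible because the root \<open>l\<close> is simple.\<close>

lemma deflate_dominant_root_nonzero:
  fixes c :: "nat \<Rightarrow> real" and l :: real
  assumes d: "d > 0" and l: "l > 0" and root: "(\<Sum>i=1..d. c i / l ^ i) = 1"
    and simple: "(\<Sum>i=1..d. of_nat i * c i / l ^ i) \<noteq> 0"
    and dom: "\<And>z::complex. z ^ d - (\<Sum>i=1..d. of_real (c i) * z ^ (d - i)) = 0 \<Longrightarrow>
        z \<noteq> of_real l \<Longrightarrow> norm z < l"
    and x: "norm x \<le> 1 / l"
  shows "(\<Sum>i<d. deflate (\<lambda>i. of_real (c i)) (of_real l) i * x ^ i) \<noteq> 0"
proof
  assume zero: "(\<Sum>i<d. deflate (\<lambda>i. of_real (c i)) (of_real l) i * x ^ i) = 0"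
  define Bp where "Bp = (\<Sum>i<d. monom (deflate (\<lambda>i. of_real (c i)) (of_real l :: complex) i) i)"
  define D where "D = 1 - (\<Sum>i=1..d. monom (complex_of_real (c i)) i)"
  have "(\<Sum>i=1..d. complex_of_real (c i) / of_real l ^ i) = 1"
    using arg_cong[OF root, of complex_of_real] by simp
  then have D: "D = [:1, - of_real l:] * Bp"
    unfolding D_def Bp_def using d l by (intro deflate_poly) auto
  have Bx: "poly Bp x = 0"
    using zero by (simp add: Bp_def poly_sum poly_monom)
  have "poly Bp 0 = 1"
    using d by (simp add: Bp_def poly_sum poly_monom power_0_left if_distrib cong: if_cong)
  with Bx have x0: "x \<noteq> 0" by auto
  have "1 - (\<Sum>i=1..d. of_real (c i) * x ^ i) = 0"
    using arg_cong[OF D, of "\<lambda>p. poly p x"] Bx by (simp add: D_def poly_sum poly_monom)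
  then have "(1 / x) ^ d * (1 - (\<Sum>i=1..d. of_real (c i) * x ^ i)) = 0"
    by simp
  then have "(1 / x) ^ d - (\<Sum>i=1..d. of_real (c i) * ((1 / x) ^ d * x ^ i)) = 0"
    by (simp add: right_diff_distrib sum_distrib_left mult_ac)
  also have "(\<Sum>i=1..d. of_real (c i) * ((1 / x) ^ d * x ^ i)) = (\<Sum>i=1..d. of_real (c i) * (1 / x) ^ (d - i))"
    using x0 by (intro sum.cong) (auto simp: power_diff field_simps)
  finally have "1 / x = of_real l \<or> norm (1 / x) < l"
    using dom by blast
  moreover have "norm (1 / x) \<ge> l"
    using x x0 l by (simp add: norm_divide field_simps)
  ultimately have *: "1 / x = of_real l"
    by auto
  have xl: "x = 1 / of_real l"
    by (simp flip: *)
  \<comment> \<open>A zero of \<open>Bp\<close> at \<open>1 / l\<close> would be a double zero of \<open>D\<close>.\<close>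
  have "poly (pderiv D) x = 0"
    unfolding D pderiv_mult poly_add poly_mult Bx using l by (simp add: xl pderiv_pCons)
  moreover have "pderiv (sum f A) = (\<Sum>i\<in>A. pderiv (f i))" for f :: "nat \<Rightarrow> complex poly" and A
    by (induction A rule: infinite_finite_induct) (simp_all add: pderiv_add)
  then have "pderiv D = - (\<Sum>i=1..d. monom (of_nat i * complex_of_real (c i)) (i - 1))"
    by (simp add: D_def pderiv_diff pderiv_monom)
  ultimately have "(\<Sum>i=1..d. of_nat i * complex_of_real (c i) * x ^ (i - 1)) = 0"
    by (simp add: poly_sum poly_monom)
  \<comment> \<open>Multiplying by \<open>x = 1 / l\<close> turns \<open>x ^ (i - 1)\<close> into
    \<open>1 / l ^ i\<close>, which produces the sum in \<open>simple\<close>.\<close>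
  then have "x * (\<Sum>i=1..d. of_nat i * complex_of_real (c i) * x ^ (i - 1)) = 0"
    by simp
  also have "x * (\<Sum>i=1..d. of_nat i * complex_of_real (c i) * x ^ (i - 1))
      = (\<Sum>i=1..d. of_nat i * complex_of_real (c i) / of_real l ^ i)"
    unfolding sum_distrib_left
  proof (intro sum.cong refl)
    fix i assume "i \<in> {1..d}"
    then obtain k where "i = Suc k" by (cases i) auto
    then show "x * (of_nat i * complex_of_real (c i) * x ^ (i - 1))
        = of_nat i * complex_of_real (c i) / of_real l ^ i"
      by (simp add: xl power_divide)
  qed
  also have "\<dots> = of_real (\<Sum>i=1..d. of_nat i * c i / l ^ i)"
    by simp
  finally show False
    using simple by (simp only: of_real_eq_0_iff)
qed

text \<open>At \<open>s = 0\<close> the deflated polynomial has no zero in the closed disc of radius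
  \<open>1 / norm (lam 0)\<close>, hence none in a slightly larger one. By continuity this persists
  for small \<open>s\<close> with a uniform lower bound. The increment is
  \<open>F (Suc n) s - lam s * F n s\<close> over \<open>lam s ^ Suc n\<close>, and the larger
  radius makes it geometrically small.\<close>

lemma quasi_power_convergence:
  fixes a F :: "nat \<Rightarrow> complex \<Rightarrow> complex" and d m :: nat and lam :: "complex \<Rightarrow> complex"
  assumes d: "d > 0" and S: "open S" "0 \<in> S"
    and a: "\<And>i. continuous_on S (a i)"
    and F: "\<And>n. continuous_on S (F n)"
    and lam: "continuous_on S lam" and nz: "\<And>s. s \<in> S \<Longrightarrow> lam s \<noteq> 0"
    and root: "\<And>s. s \<in> S \<Longrightarrow> (\<Sum>i=1..d. a i s / lam s ^ i) = 1"
    and rec: "\<And>n s. n \<ge> m \<Longrightarrow> s \<in> S \<Longrightarrow>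
      F n s = (\<Sum>i=1..d. a i s * (if i \<le> n then F (n - i) s else 0))"
    and dom: "\<And>x. norm x \<le> 1 / norm (lam 0) \<Longrightarrow>
      (\<Sum>i<d. deflate (\<lambda>i. a i 0) (lam 0) i * x ^ i) \<noteq> 0"
  obtains \<delta> \<gamma> C where "\<delta> > 0" "0 < \<gamma>" "\<gamma> < 1" "cball 0 \<delta> \<subseteq> S"
    "\<And>s n. s \<in> cball 0 \<delta> \<Longrightarrow>
      norm (F (Suc n) s / lam s ^ Suc n - F n s / lam s ^ n) \<le> C * \<gamma> ^ n"
proof -
  define b where "b i s = deflate (\<lambda>i. a i s) (lam s) i" for i s
  define \<rho> where "\<rho> = 1 / norm (lam 0)"
  have \<rho>: "\<rho> > 0"
    using nz S by (simp add: \<rho>_def)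
  define Bp where "Bp = (\<Sum>i<d. monom (b i 0) i)"
  have Bp: "poly Bp x = (\<Sum>i<d. b i 0 * x ^ i)" for x
    by (simp add: Bp_def poly_sum poly_monom)
  have dom': "poly Bp x \<noteq> 0" if "norm x \<le> \<rho>" for x
    using dom that by (simp add: Bp b_def \<rho>_def)
  have "Bp \<noteq> 0"
    using dom'[of 0] \<rho> by auto
  define Z where "Z = norm ` {x. poly Bp x = 0}"
  have Z: "finite Z"
    unfolding Z_def using poly_roots_finite[OF \<open>Bp \<noteq> 0\<close>] by simp
  obtain R where R: "R > \<rho>" "\<And>z. z \<in> Z \<Longrightarrow> R < z"
  proof -
    \<comment> \<open>Inserting \<open>\<rho> + 1\<close> keeps the minimum defined when
      \<open>Bp\<close> has no zeros; \<open>R\<close> will be the midpoint of \<open>\<rho>\<close>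
      and \<open>R0\<close>.\<close>
    define R0 where "R0 = Min (insert (\<rho> + 1) Z)"
    have "R0 > \<rho>"
      unfolding R0_def using Z dom' by (subst Min_gr_iff) (auto simp: Z_def not_le[symmetric])
    moreover have "R0 \<le> z" if "z \<in> Z" for z
      unfolding R0_def using Z that by auto
    ultimately show thesis
      using that[of "(\<rho> + R0) / 2"] by fastforce
  qed
  have Rpos: "R > 0" using R \<rho> by simp
  have "poly Bp x \<noteq> 0" if "x \<in> cball 0 R" for x
    using R(2)[of "norm x"] that by (auto simp: Z_def)
  moreover have "compact ((\<lambda>x. norm (poly Bp x)) ` cball 0 R)"
    by (intro compact_continuous_image continuous_intros) auto
  moreover have "(\<lambda>x. norm (poly Bp x)) ` cball (0::complex) R \<noteq> {}"
    using Rpos by simp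
  ultimately obtain \<epsilon> where \<epsilon>: "\<epsilon> > 0" "\<And>x. norm x \<le> R \<Longrightarrow> norm (poly Bp x) \<ge> \<epsilon>"
    using compact_attains_inf[of "(\<lambda>x. norm (poly Bp x)) ` cball 0 R"]
    by (smt (verit) imageE imageI mem_cball_0 zero_less_norm_iff)
  have at0: "isCont f 0" if "continuous_on S f" for f :: "complex \<Rightarrow> complex"
    using that S by (simp add: continuous_on_eq_continuous_at)
  note cont0 [continuous_intros] = at0[OF a] at0[OF F] at0[OF lam]
  have b: "isCont (b i) 0" for i
    unfolding b_def deflate_def by (intro continuous_intros)
  \<comment> \<open>The midpoint of \<open>\<rho> / R\<close> and 1 leaves room for
    \<open>lam s\<close> to differ from \<open>lam 0\<close>.\<close>
  define \<gamma> where "\<gamma> = (1 + \<rho> / R) / 2"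
  have \<gamma>: "0 < \<gamma>" "\<gamma> < 1" "\<rho> / R < \<gamma>"
    using R \<rho> Rpos by (auto simp: \<gamma>_def field_simps)
  define rhs where "rhs n s = (\<Sum>i=1..d. a i s * (if i \<le> n then F (n - i) s else 0))" for n s
  have "isCont (\<lambda>s. if i \<le> n then F (n - i) s else 0) 0" for i n
    by (cases "i \<le> n") (simp_all add: cont0)
  then have rhs: "isCont (rhs n) 0" for n
    unfolding rhs_def by (intro continuous_intros)
  \<comment> \<open>On the disc of radius \<open>R\<close>, \<open>N s\<close> bounds the numerator
    polynomial, and \<open>dB s\<close> bounds the change of the deflated polynomial between the
    parameters 0 and \<open>s\<close>.\<close>
  define N where "N s = (\<Sum>n<m. norm (F n s - rhs n s) * R ^ n)" for s
  define dB where "dB s = (\<Sum>i<d. norm (b i s - b i 0) * R ^ i)" for s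
  have "isCont N 0" unfolding N_def by (intro continuous_intros rhs)
  then have ev1: "eventually (\<lambda>s. N s < N 0 + 1) (nhds 0)"
    by (intro order_tendstoD) (auto simp: continuous_at tendsto_nhds_iff)
  have "isCont dB 0" unfolding dB_def by (intro continuous_intros b)
  then have ev2: "eventually (\<lambda>s. dB s < \<epsilon> / 2) (nhds 0)"
    using \<epsilon>(1) by (intro order_tendstoD[of dB "dB 0"]) (auto simp: continuous_at tendsto_nhds_iff dB_def)
  have "isCont (\<lambda>s. 1 / (R * norm (lam s))) 0"
    using Rpos nz[OF S(2)] by (intro continuous_intros) auto
  then have ev3: "eventually (\<lambda>s. 1 / (R * norm (lam s)) < \<gamma>) (nhds 0)"
    using \<gamma>(3) by (intro order_tendstoD[of _ "1 / (R * norm (lam 0))"])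
      (auto simp: continuous_at tendsto_nhds_iff \<rho>_def field_simps)
  have "eventually (\<lambda>s. s \<in> S \<and> N s < N 0 + 1 \<and> dB s < \<epsilon> / 2 \<and> 1 / (R * norm (lam s)) < \<gamma>) (nhds 0)"
    using ev1 ev2 ev3 eventually_nhds_in_open[OF S] by eventually_elim auto
  then obtain \<delta> where "\<delta> > 0" and \<delta>: "\<And>s. dist s 0 < \<delta> \<Longrightarrow>
      s \<in> S \<and> N s < N 0 + 1 \<and> dB s < \<epsilon> / 2 \<and> 1 / (R * norm (lam s)) < \<gamma>"
    unfolding eventually_nhds_metric by blast
  \<comment> \<open>The perturbation \<open>dB s < \<epsilon> / 2\<close> costs half of the lower
    bound \<open>\<epsilon>\<close>.\<close>
  define C where "C = (N 0 + 1) / (\<epsilon> / 2)"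
  have "N 0 \<ge> 0" unfolding N_def using Rpos by (intro sum_nonneg) auto
  then have C: "C > 0" unfolding C_def using \<epsilon> by simp
  show thesis
  proof
    show "\<delta> / 2 > 0" "0 < \<gamma>" "\<gamma> < 1" using \<open>\<delta> > 0\<close> \<gamma> by auto
    show "cball 0 (\<delta> / 2) \<subseteq> S" using \<delta> \<open>\<delta> > 0\<close> by (auto simp: dist_norm)
    fix s n assume s: "s \<in> cball (0::complex) (\<delta> / 2)"
    have sS: "s \<in> S" and Ns: "N s < N 0 + 1" and dBs: "dB s < \<epsilon> / 2" and gs: "1 / (R * norm (lam s)) < \<gamma>"
      using \<delta>[of s] s \<open>\<delta> > 0\<close> by (auto simp: dist_norm)
    have "norm (F (Suc n) s - lam s * F n s) \<le> (N 0 + 1) / (\<epsilon> / 2) / R ^ Suc n"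
    proof (rule deflated_recurrence_bound[where a = "\<lambda>i. a i s" and F = "\<lambda>n. F n s" and d = d and m = m])
      show "(\<Sum>n<m. cmod (F n s - (\<Sum>i = 1..d. a i s * (if i \<le> n then F (n - i) s else 0))) * R ^ n)
          \<le> N 0 + 1"
        using Ns by (simp add: N_def rhs_def)
      show "\<epsilon> / 2 \<le> norm (\<Sum>i<d. deflate (\<lambda>i. a i s) (lam s) i * x ^ i)" if x: "norm x \<le> R" for x
      proof -
        have "norm ((\<Sum>i<d. b i s * x ^ i) - poly Bp x) = norm (\<Sum>i<d. (b i s - b i 0) * x ^ i)"
          by (simp add: Bp left_diff_distrib sum_subtractf)
        also have "\<dots> \<le> (\<Sum>i<d. norm (b i s - b i 0) * R ^ i)"
          using x by (intro sum_norm_le) (auto simp: norm_mult norm_power intro!: mult_left_mono power_mono)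
        also have "\<dots> < \<epsilon> / 2"
          using dBs by (simp add: dB_def)
        finally show ?thesis
          using \<epsilon>(2)[OF x] unfolding b_def by norm
      qed
    qed (use d nz root rec sS Rpos \<epsilon> in auto)
    then have "norm (F (Suc n) s - lam s * F n s) / norm (lam s) ^ Suc n
        \<le> C / R ^ Suc n / norm (lam s) ^ Suc n"
      unfolding C_def by (intro divide_right_mono) auto
    also have "\<dots> = C * (1 / (R * norm (lam s))) ^ Suc n"
      by (simp add: power_divide power_mult_distrib)
    also have "\<dots> \<le> C * \<gamma> ^ Suc n"
      using C gs Rpos by (intro mult_left_mono power_mono) auto
    also have "\<dots> \<le> (C * \<gamma>) * \<gamma> ^ n"
      by simp
    also have "norm (F (Suc n) s - lam s * F n s) / norm (lam s) ^ Suc n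
        = norm ((F (Suc n) s - lam s * F n s) / lam s ^ Suc n)"
      by (simp only: norm_divide norm_power)
    also have "(F (Suc n) s - lam s * F n s) / lam s ^ Suc n
        = F (Suc n) s / lam s ^ Suc n - F n s / lam s ^ n"
      using nz[OF sS] by (simp add: diff_divide_distrib)
    finally show "norm (F (Suc n) s / lam s ^ Suc n - F n s / lam s ^ n) \<le> (C * \<gamma>) * \<gamma> ^ n" .
  qed
qed

section \<open>Geometric convergence and quasi-powers\<close>

text \<open>The increments form an absolutely convergent series, and the distance from
  \<open>x n\<close> to the limit is one of its tails.\<close>

lemma geometric_increments_limit:
  fixes x :: "nat \<Rightarrow> 'a::banach"
  assumes "\<And>n. norm (x (Suc n) - x n) \<le> C * \<gamma> ^ n" and \<gamma>: "0 < \<gamma>" "\<gamma> < 1"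
  obtains l where "\<And>n. norm (l - x n) \<le> C / (1 - \<gamma>) * \<gamma> ^ n"
proof -
  define y where "y n = x (Suc n) - x n" for n
  have g: "summable (\<lambda>n. C * \<gamma> ^ n)"
    using \<gamma> by (intro summable_mult summable_geometric) auto
  have y: "norm (y n) \<le> C * \<gamma> ^ n" for n
    using assms by (simp add: y_def)
  have sy: "summable y"
    using g y by (rule summable_comparison_test')
  show thesis
  proof
    fix n
    have "(\<Sum>k. y k) = (\<Sum>k. y (k + n)) + (\<Sum>k<n. y k)"
      by (rule suminf_split_initial_segment[OF sy])
    moreover have "(\<Sum>k<n. y k) = x n - x 0"
      unfolding y_def by (rule sum_lessThan_telescope)
    ultimately have "x 0 + (\<Sum>k. y k) - x n = (\<Sum>k. y (k + n))"
      by simp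
    also have "norm \<dots> \<le> (\<Sum>k. C * \<gamma> ^ (k + n))"
      using g y by (intro norm_suminf_le) (auto simp: summable_iff_shift[of "\<lambda>n. C * \<gamma> ^ n"])
    also have "(\<lambda>k. C * \<gamma> ^ (k + n)) = (\<lambda>k. C * \<gamma> ^ n * \<gamma> ^ k)"
      by (simp add: power_add mult_ac)
    also have "(\<Sum>k. C * \<gamma> ^ n * \<gamma> ^ k) = C * \<gamma> ^ n * (1 / (1 - \<gamma>))"
      using \<gamma> by (simp add: suminf_mult summable_geometric suminf_geometric)
    finally show "norm (x 0 + (\<Sum>k. y k) - x n) \<le> C / (1 - \<gamma>) * \<gamma> ^ n"
      by simp
  qed
qed

text \<open>Cauchy's inequality transfers the increment bound to the derivatives at 0, at the cost
  of the constant factor \<open>fact k / \<delta> ^ k\<close>.\<close>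

lemma higher_deriv_geometric_limit:
  fixes u :: "nat \<Rightarrow> complex \<Rightarrow> complex"
  assumes S: "open S" "cball 0 \<delta> \<subseteq> S" "\<delta> > 0" and u: "\<And>n. u n holomorphic_on S"
    and inc: "\<And>s n. s \<in> cball 0 \<delta> \<Longrightarrow> norm (u (Suc n) s - u n s) \<le> C * \<gamma> ^ n"
    and \<gamma>: "0 < \<gamma>" "\<gamma> < 1"
  obtains l where "(\<lambda>n. (deriv ^^ k) (u n) 0 - l) \<in> O(\<lambda>n. of_real (\<gamma> ^ n))"
proof -
  have "norm ((deriv ^^ k) (u (Suc n)) 0 - (deriv ^^ k) (u n) 0) \<le> fact k * C / \<delta> ^ k * \<gamma> ^ n" for n
  proof -
    have hol: "(\<lambda>s. u (Suc n) s - u n s) holomorphic_on S"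
      by (intro holomorphic_intros u)
    have "norm ((deriv ^^ k) (\<lambda>s. u (Suc n) s - u n s) 0) \<le> fact k * (C * \<gamma> ^ n) / \<delta> ^ k"
    proof (rule Cauchy_inequality)
      show "(\<lambda>s. u (Suc n) s - u n s) holomorphic_on ball 0 \<delta>"
        using holomorphic_on_subset[OF hol] S(2) ball_subset_cball by blast
      show "continuous_on (cball 0 \<delta>) (\<lambda>s. u (Suc n) s - u n s)"
        using holomorphic_on_imp_continuous_on[OF hol] S(2) continuous_on_subset by blast
    qed (use S inc in auto)
    moreover have "(deriv ^^ k) (\<lambda>s. u (Suc n) s - u n s) 0
        = (deriv ^^ k) (u (Suc n)) 0 - (deriv ^^ k) (u n) 0"
      using S by (intro higher_deriv_diff[OF u u S(1)]) auto
    ultimately show ?thesis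
      by (simp add: mult_ac)
  qed
  from geometric_increments_limit[OF this \<gamma>] obtain l
    where l: "\<And>n. norm (l - (deriv ^^ k) (u n) 0) \<le> fact k * C / \<delta> ^ k / (1 - \<gamma>) * \<gamma> ^ n"
    by blast
  have "(\<lambda>n. (deriv ^^ k) (u n) 0 - l) \<in> O(\<lambda>n. of_real (\<gamma> ^ n))"
    using l \<gamma> by (intro bigoI[of _ "fact k * C / \<delta> ^ k / (1 - \<gamma>)"] always_eventually allI)
       (simp add: norm_minus_commute norm_power)
  then show thesis by (rule that)
qed

text \<open>The difference equals \<open>((x - a) * b - a * (y - b)) / (y * b)\<close>, and
  \<open>1 / y\<close> stays bounded because \<open>b\<close> is nonzero.\<close>

lemma bigo_geometric_divide:
  fixes x y :: "nat \<Rightarrow> complex"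
  assumes x: "(\<lambda>n. x n - a) \<in> O(\<lambda>n. of_real (\<gamma> ^ n))" and y: "(\<lambda>n. y n - b) \<in> O(\<lambda>n. of_real (\<gamma> ^ n))"
    and lim: "y \<longlonglongrightarrow> b" and b: "b \<noteq> 0"
  shows "(\<lambda>n. x n / y n - a / b) \<in> O(\<lambda>n. of_real (\<gamma> ^ n))"
proof -
  have "(\<lambda>n. inverse (y n) / b) \<longlonglongrightarrow> inverse b / b"
    using lim b by (intro tendsto_intros)
  then have "(\<lambda>n. inverse (y n) / b) \<in> O(\<lambda>_. 1)"
    by (intro bigoI_tendsto) auto
  moreover have "(\<lambda>n. (x n - a) * b - a * (y n - b)) \<in> O(\<lambda>n. of_real (\<gamma> ^ n))"
    using x y by (intro sum_in_bigo) (auto simp: mult.commute[of _ b])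
  ultimately have "(\<lambda>n. ((x n - a) * b - a * (y n - b)) * (inverse (y n) / b))
      \<in> O(\<lambda>n. of_real (\<gamma> ^ n) * 1)"
    using landau_o.big.mult by blast
  moreover have "eventually (\<lambda>n. y n \<noteq> 0) sequentially"
    using lim b by (rule tendsto_imp_eventually_ne)
  then have "eventually (\<lambda>n. ((x n - a) * b - a * (y n - b)) * (inverse (y n) / b)
      = x n / y n - a / b) sequentially"
    by eventually_elim (use b in \<open>simp add: field_simps\<close>)
  ultimately show ?thesis
    by (simp only: mult_1_right landau_o.big.in_cong)
qed

lemma bigo_square_diff:
  fixes r :: "nat \<Rightarrow> complex"
  assumes r: "(\<lambda>n. r n - l) \<in> O(g)" and lim: "r \<longlonglongrightarrow> l"
  shows "(\<lambda>n. (r n)\<^sup>2 - l\<^sup>2) \<in> O(g)"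
proof -
  have "(\<lambda>n. r n + l) \<longlonglongrightarrow> l + l"
    by (intro tendsto_intros lim)
  then have "(\<lambda>n. r n + l) \<in> O(\<lambda>_. 1)"
    by (intro bigoI_tendsto) auto
  then have "(\<lambda>n. (r n - l) * (r n + l)) \<in> O(\<lambda>n. g n * 1)"
    by (rule landau_o.big.mult[OF r])
  then show ?thesis
    by (simp add: power2_eq_square algebra_simps)
qed

lemma bigo_geometric_imp_tendsto:
  fixes x :: "nat \<Rightarrow> complex"
  assumes "(\<lambda>n. x n - l) \<in> O(\<lambda>n. of_real (\<gamma> ^ n))" "0 < \<gamma>" "\<gamma> < 1"
  shows "x \<longlonglongrightarrow> l"
proof -
  have "(\<lambda>n. complex_of_real (\<gamma> ^ n)) \<longlonglongrightarrow> of_real 0"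
    using assms by (intro tendsto_of_real LIMSEQ_power_zero) auto
  then have "(\<lambda>n. complex_of_real (\<gamma> ^ n)) \<in> o(\<lambda>_. 1)"
    by (intro smalloI_tendsto) auto
  with assms(1) have "(\<lambda>n. x n - l) \<in> o(\<lambda>_. 1)"
    by (rule landau_o.big_small_trans)
  then have "(\<lambda>n. x n - l) \<longlonglongrightarrow> 0"
    by (auto dest: smalloD_tendsto)
  then show ?thesis
    using LIM_zero_cancel by blast
qed

text \<open>Carries complex estimates back to real sequences. Agreement for large \<open>n\<close>
  is enough, which matters since finitely many rows may have total 0.\<close>

lemma bigo_Re:
  fixes x :: "nat \<Rightarrow> complex" and y g :: "nat \<Rightarrow> real"
  assumes x: "x \<in> O(\<lambda>n. of_real (g n))" and eq: "eventually (\<lambda>n. y n = Re (x n)) sequentially"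
  shows "y \<in> O(g)"
proof -
  obtain C where C: "eventually (\<lambda>n. norm (x n) \<le> C * norm (complex_of_real (g n))) sequentially"
    using x by (elim landau_o.bigE)
  show ?thesis
  proof (rule bigoI)
    show "eventually (\<lambda>n. norm (y n) \<le> C * norm (g n)) sequentially"
      using C eq by eventually_elim (use abs_Re_le_cmod order_trans in fastforce)
  qed
qed

text \<open>These are the first two derivatives of \<open>log F = c * L + log u\<close> at 0,
  written as quotients so that no branch of the logarithm has to be chosen.\<close>

lemma exp_mult_log_derivs:
  fixes L u :: "complex \<Rightarrow> complex"
  assumes S: "open S" "0 \<in> S" and L: "L holomorphic_on S" and u: "u holomorphic_on S"
    and F: "\<And>s. s \<in> S \<Longrightarrow> F s = exp (c * L s) * u s" and nz: "u 0 \<noteq> 0"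
  shows "deriv F 0 / F 0 = c * deriv L 0 + deriv u 0 / u 0"
    and "deriv (deriv F) 0 / F 0 - (deriv F 0 / F 0)\<^sup>2
      = c * deriv (deriv L) 0 + (deriv (deriv u) 0 / u 0 - (deriv u 0 / u 0)\<^sup>2)"
proof -
  have D: "(L has_field_derivative deriv L s) (at s)" "(u has_field_derivative deriv u s) (at s)"
    "(deriv L has_field_derivative deriv (deriv L) s) (at s)"
    "(deriv u has_field_derivative deriv (deriv u) s) (at s)" if "s \<in> S" for s
    using that S(1) L u by (auto intro: holomorphic_derivI holomorphic_deriv)
  have 1: "(F has_field_derivative exp (c * L s) * (c * deriv L s * u s + deriv u s)) (at s)"
    if s: "s \<in> S" for s
  proof (rule DERIV_cong[OF has_field_derivative_transform_within_open[OF _ S(1) s]])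
    show "((\<lambda>s. exp (c * L s) * u s) has_field_derivative
        (exp (c * L s) * (c * deriv L s) * u s + exp (c * L s) * deriv u s)) (at s)"
      using s by (auto intro!: derivative_eq_intros D)
  qed (use F in \<open>auto simp: algebra_simps\<close>)
  have 2: "deriv F s = exp (c * L s) * (c * deriv L s * u s + deriv u s)" if "s \<in> S" for s
    using 1[OF that] by (rule DERIV_imp_deriv)
  have 3: "(deriv F has_field_derivative exp (c * L 0) * (c * deriv L 0 * (c * deriv L 0 * u 0 + deriv u 0) +
      c * deriv (deriv L) 0 * u 0 + c * deriv L 0 * deriv u 0 + deriv (deriv u) 0)) (at 0)"
  proof (rule has_field_derivative_transform_within_open[OF _ S])
    show "((\<lambda>s. exp (c * L s) * (c * deriv L s * u s + deriv u s)) has_field_derivative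
      exp (c * L 0) * (c * deriv L 0 * (c * deriv L 0 * u 0 + deriv u 0) +
      c * deriv (deriv L) 0 * u 0 + c * deriv L 0 * deriv u 0 + deriv (deriv u) 0)) (at 0)"
      using S by (auto intro!: derivative_eq_intros D simp: algebra_simps)
  qed (use 2 in auto)
  show m: "deriv F 0 / F 0 = c * deriv L 0 + deriv u 0 / u 0"
    using nz by (simp add: 2 F S field_simps)
  show "deriv (deriv F) 0 / F 0 - (deriv F 0 / F 0)\<^sup>2
      = c * deriv (deriv L) 0 + (deriv (deriv u) 0 / u 0 - (deriv u 0 / u 0)\<^sup>2)"
    unfolding m using nz by (simp add: DERIV_imp_deriv[OF 3] F S field_simps power2_eq_square)
qed


text \<open>Taylor's theorem, with the third derivative bounded on a compact disc. A cubic error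
  stays negligible after multiplication by \<open>n\<close> at arguments of size
  \<open>1 / sqrt n\<close>.\<close>

lemma holomorphic_second_order_expansion:
  assumes S: "open S" "0 \<in> S" and L: "L holomorphic_on S"
  obtains \<delta> K where "\<delta> > 0"
    "\<And>s. norm s \<le> \<delta> \<Longrightarrow>
      norm (L s - L 0 - deriv L 0 * s - deriv (deriv L) 0 * s\<^sup>2 / 2) \<le> K * norm s ^ 3"
proof -
  obtain \<delta> where \<delta>: "\<delta> > 0" "cball 0 \<delta> \<subseteq> S"
    using S open_contains_cball by blast
  have "continuous_on (cball 0 \<delta>) ((deriv ^^ 3) L)"
    using holomorphic_on_imp_continuous_on[OF holomorphic_higher_deriv[OF L S(1)]] \<delta>(2)
    by (rule continuous_on_subset)
  then have "bounded ((deriv ^^ 3) L ` cball 0 \<delta>)"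
    by (intro compact_imp_bounded compact_continuous_image) auto
  then obtain K where K: "\<And>s. norm s \<le> \<delta> \<Longrightarrow> norm ((deriv ^^ 3) L s) \<le> K"
    unfolding bounded_iff by (metis imageI mem_cball_0)
  show thesis
  proof
    fix s :: complex assume s: "norm s \<le> \<delta>"
    have "norm ((deriv ^^ 0) L s - (\<Sum>i\<le>2. (deriv ^^ i) L 0 * (s - 0) ^ i / fact i)) \<le> K * norm (s - 0) ^ Suc 2 / fact 2"
    proof (rule complex_Taylor[where S = "cball 0 \<delta>" and f = "\<lambda>i. (deriv ^^ i) L"])
      show "((deriv ^^ i) L has_field_derivative (deriv ^^ Suc i) L x) (at x within cball 0 \<delta>)"
        if "x \<in> cball 0 \<delta>" for x i
        using holomorphic_derivI[OF holomorphic_higher_deriv[OF L S(1), of i] S(1)] that \<delta>(2)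
        by (auto intro: DERIV_subset)
    qed (use s \<delta> K in \<open>auto simp: eval_nat_numeral\<close>)
    then show "norm (L s - L 0 - deriv L 0 * s - deriv (deriv L) 0 * s\<^sup>2 / 2) \<le> K / 2 * norm s ^ 3"
      by (simp add: eval_nat_numeral algebra_simps)
  qed fact
qed

text \<open>Expand \<open>n * (L s - L 0) - \<i> * \<theta> * \<mu> n / \<sigma> n\<close> at
  \<open>s = \<i> * \<theta> / \<sigma> n\<close>. The linear terms cancel up to a bounded multiple
  of \<open>1 / \<sigma> n\<close>, the quadratic term tends to
  \<open>- \<theta>\<^sup>2 / 2\<close> because \<open>(\<sigma> n)\<^sup>2\<close> is asymptotic to
  \<open>b * n\<close>, and the remainder is of order \<open>n / \<sigma> n ^ 3\<close>. The
  quotient of the values of \<open>u n\<close> at \<open>s\<close> and 0 tends to 1.\<close>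

lemma quasi_power_char_tendsto:
  fixes L :: "complex \<Rightarrow> complex" and u :: "nat \<Rightarrow> complex \<Rightarrow> complex" and \<mu> \<sigma> :: "nat \<Rightarrow> real"
  assumes S: "open S" "cball 0 \<delta> \<subseteq> S" "\<delta> > 0" and L: "L holomorphic_on S"
    and u: "\<And>n. continuous_on S (u n)"
    and inc: "\<And>s n. s \<in> cball 0 \<delta> \<Longrightarrow> norm (u (Suc n) s - u n s) \<le> C * \<gamma> ^ n"
    and \<gamma>: "0 < \<gamma>" "\<gamma> < 1"
    and u0: "(\<lambda>n. u n 0) \<longlonglongrightarrow> c" "c \<noteq> 0"
    and d1: "deriv L 0 = of_real a" and d2: "deriv (deriv L) 0 = of_real b" and b: "b > 0"
    and \<mu>: "(\<lambda>n. \<mu> n - a * real n) \<in> O(\<lambda>_. 1)"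
    and \<sigma>: "(\<lambda>n. (\<sigma> n)\<^sup>2 - b * real n) \<in> O(\<lambda>_. 1)" "\<And>n. \<sigma> n \<ge> 0"
  shows "(\<lambda>n. exp (- \<i> * of_real (\<theta> * \<mu> n / \<sigma> n)) *
      (exp (of_nat n * L (\<i> * of_real (\<theta> / \<sigma> n))) * u n (\<i> * of_real (\<theta> / \<sigma> n)) /
        (exp (of_nat n * L 0) * u n 0))) \<longlonglongrightarrow> of_real (exp (- (\<theta>\<^sup>2) / 2))"
proof -
  have o1: "(\<lambda>n. f n / real n) \<longlonglongrightarrow> 0" if "f \<in> O(\<lambda>_. 1)" for f :: "nat \<Rightarrow> real"
  proof -
    have "(\<lambda>_. 1) \<in> o(\<lambda>n. real n)" by real_asymp
    with that have "f \<in> o(\<lambda>n. real n)" by (rule landau_o.big_small_trans)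
    then show ?thesis by (rule smalloD_tendsto)
  qed
  have "(\<lambda>n. ((\<sigma> n)\<^sup>2 - b * real n) / real n + b) \<longlonglongrightarrow> 0 + b"
    by (intro tendsto_intros o1 \<sigma>)
  moreover have "eventually (\<lambda>n. ((\<sigma> n)\<^sup>2 - b * real n) / real n + b = (\<sigma> n)\<^sup>2 / real n) sequentially"
    using eventually_gt_at_top[of 0] by eventually_elim (simp add: field_simps)
  ultimately have s2: "(\<lambda>n. (\<sigma> n)\<^sup>2 / real n) \<longlonglongrightarrow> b"
    by (simp add: tendsto_cong)
  have s2': "(\<lambda>n. real n / (\<sigma> n)\<^sup>2) \<longlonglongrightarrow> 1 / b"
    using tendsto_inverse[OF s2] b by (simp add: field_simps)
  have "filterlim (\<lambda>n. (\<sigma> n)\<^sup>2 / real n * real n) at_top sequentially"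
    by (rule filterlim_tendsto_pos_mult_at_top[OF s2 b filterlim_real_sequentially])
  moreover have *: "eventually (\<lambda>n. (\<sigma> n)\<^sup>2 / real n * real n = (\<sigma> n)\<^sup>2) sequentially"
    using eventually_gt_at_top[of 0] by eventually_elim simp
  ultimately have "filterlim (\<lambda>n. (\<sigma> n)\<^sup>2) at_top sequentially"
    by (simp only: filterlim_cong[OF refl refl *])
  then have "filterlim (\<lambda>n. sqrt ((\<sigma> n)\<^sup>2)) at_top sequentially"
    by (rule filterlim_compose[OF sqrt_at_top])
  then have \<sigma>inf: "filterlim \<sigma> at_top sequentially"
    using \<sigma>(2) by simp
  define s where "s n = \<i> * complex_of_real (\<theta> / \<sigma> n)" for n
  have inv\<sigma>: "(\<lambda>n. 1 / \<sigma> n) \<longlonglongrightarrow> 0"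
    using tendsto_inverse_0_at_top[OF \<sigma>inf] by (simp add: field_simps)
  have "(\<lambda>n. \<i> * of_real (\<theta> * (1 / \<sigma> n))) \<longlonglongrightarrow> \<i> * of_real (\<theta> * 0)"
    by (intro tendsto_intros inv\<sigma>)
  then have s0: "s \<longlonglongrightarrow> 0" by (simp add: s_def[abs_def])
  define R where "R z = L z - L 0 - deriv L 0 * z - deriv (deriv L) 0 * z\<^sup>2 / 2" for z
  obtain \<eta> K where \<eta>: "\<eta> > 0" "\<And>z. norm z \<le> \<eta> \<Longrightarrow> norm (R z) \<le> K * norm z ^ 3"
    using holomorphic_second_order_expansion[OF S(1) _ L] S unfolding R_def by (metis centre_in_cball less_imp_le subsetD)
  have ev\<eta>: "eventually (\<lambda>n. norm (s n) < \<eta>) sequentially"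
    using tendsto_norm[OF s0] \<eta>(1) by (intro order_tendstoD) auto
  \<comment> \<open>A convergent factor times a null factor, so the cubic remainder disappears in
    the limit.\<close>
  have nrm: "real n * norm (s n) ^ 3 = real n / (\<sigma> n)\<^sup>2 * (\<bar>\<theta>\<bar> ^ 3 * (1 / \<sigma> n))" for n
  proof -
    have "norm (s n) = \<bar>\<theta>\<bar> / \<sigma> n"
      using \<sigma>(2)[of n] by (simp add: s_def norm_mult norm_divide)
    then show ?thesis
      by (simp add: eval_nat_numeral)
  qed
  have K0: "(\<lambda>n. K * (real n / (\<sigma> n)\<^sup>2 * (\<bar>\<theta>\<bar> ^ 3 * (1 / \<sigma> n)))) \<longlonglongrightarrow> K * (1 / b * (\<bar>\<theta>\<bar> ^ 3 * 0))"
    by (intro tendsto_intros s2' inv\<sigma>)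
  have bd: "eventually (\<lambda>n. norm (of_nat n * R (s n)) \<le> K * (real n * norm (s n) ^ 3)) sequentially"
    using ev\<eta>
  proof eventually_elim
    case (elim n)
    then have "norm (R (s n)) \<le> K * norm (s n) ^ 3" by (intro \<eta>(2)) simp
    then have "real n * norm (R (s n)) \<le> real n * (K * norm (s n) ^ 3)"
      by (intro mult_left_mono) auto
    then show ?case by (simp add: norm_mult mult_ac)
  qed
  have "(\<lambda>n. K * (real n * norm (s n) ^ 3)) \<longlonglongrightarrow> 0"
    using K0 by (simp only: nrm mult_zero_right)
  with bd have R0: "(\<lambda>n. of_nat n * R (s n)) \<longlonglongrightarrow> 0"
    by (rule Lim_null_comparison)
  have "(\<lambda>n. 1 / \<sigma> n) \<in> o(\<lambda>_. 1)"
    using inv\<sigma> by (intro smalloI_tendsto) auto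
  then have "(\<lambda>n. (\<mu> n - a * real n) * (1 / \<sigma> n)) \<in> o(\<lambda>n. 1 * 1)"
    using \<mu> by (rule landau_o.big_small_mult[rotated])
  then have \<mu>0: "(\<lambda>n. (\<mu> n - a * real n) * (1 / \<sigma> n)) \<longlonglongrightarrow> 0"
    by (auto dest: smalloD_tendsto)
  \<comment> \<open>The summands are the Taylor remainder, the quadratic term and the mismatch of
    the linear terms; \<open>d1\<close> and \<open>d2\<close> recombine them into the
    exponent.\<close>
  have "(\<lambda>n. of_nat n * R (s n) + of_real (b / 2 * - (\<theta>\<^sup>2 * (real n / (\<sigma> n)\<^sup>2)))
        - \<i> * of_real (\<theta> * ((\<mu> n - a * real n) * (1 / \<sigma> n))))
      \<longlonglongrightarrow> 0 + of_real (b / 2 * - (\<theta>\<^sup>2 * (1 / b))) - \<i> * of_real (\<theta> * 0)"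
    by (intro tendsto_intros R0 s2' \<mu>0)
  moreover have "of_nat n * R (s n) + of_real (b / 2 * - (\<theta>\<^sup>2 * (real n / (\<sigma> n)\<^sup>2)))
        - \<i> * of_real (\<theta> * ((\<mu> n - a * real n) * (1 / \<sigma> n)))
      = of_nat n * L (s n) - of_nat n * L 0 - \<i> * of_real (\<theta> * \<mu> n / \<sigma> n)" for n
    by (simp add: R_def d1 d2 s_def field_simps power2_eq_square) (simp add: diff_divide_distrib)
  moreover have "b / 2 * - (\<theta>\<^sup>2 * (1 / b)) = - \<theta>\<^sup>2 / 2"
    using b by (simp add: field_simps)
  ultimately have E: "(\<lambda>n. of_nat n * L (s n) - of_nat n * L 0 - \<i> * of_real (\<theta> * \<mu> n / \<sigma> n))
      \<longlonglongrightarrow> of_real (- \<theta>\<^sup>2 / 2)"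
    by (simp only: add_0_left mult_zero_right of_real_0 diff_zero)
  have "\<exists>l. \<forall>n. norm (l - u n z) \<le> C / (1 - \<gamma>) * \<gamma> ^ n" if "z \<in> cball 0 \<delta>" for z
    using geometric_increments_limit[OF inc[OF that] \<gamma>] by blast
  then obtain g where g: "\<And>z n. z \<in> cball 0 \<delta> \<Longrightarrow> norm (g z - u n z) \<le> C / (1 - \<gamma>) * \<gamma> ^ n"
    by metis
  have g0: "(\<lambda>n. C / (1 - \<gamma>) * \<gamma> ^ n) \<longlonglongrightarrow> 0"
    using \<gamma> by (intro tendsto_mult_right_zero LIMSEQ_power_zero) auto
  \<comment> \<open>Uniformity matters because the argument \<open>s n\<close> moves with
    \<open>n\<close>; it also makes the limit \<open>g\<close> continuous.\<close>
  have ul: "uniform_limit (cball 0 \<delta>) u g sequentially"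
  proof (rule uniform_limitI)
    fix e :: real assume "e > 0"
    then have "eventually (\<lambda>n. C / (1 - \<gamma>) * \<gamma> ^ n < e) sequentially"
      using g0 by (intro order_tendstoD) auto
    then show "eventually (\<lambda>n. \<forall>z\<in>cball 0 \<delta>. dist (u n z) (g z) < e) sequentially"
      by eventually_elim (auto simp: dist_norm norm_minus_commute intro: le_less_trans[OF g])
  qed
  then have contg: "continuous_on (cball 0 \<delta>) g"
    using u S(2) by (intro uniform_limit_theorem[OF _ ul] always_eventually allI) (auto intro: continuous_on_subset)
  have "(\<lambda>n. u n 0) \<longlonglongrightarrow> g 0"
    using tendsto_uniform_limitI[OF ul, of 0] S(3) by simp
  then have gc: "g 0 = c"
    using u0(1) LIMSEQ_unique by blast
  have evs: "eventually (\<lambda>n. s n \<in> cball 0 \<delta>) sequentially"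
    using order_tendstoD(2)[OF tendsto_norm[OF s0], of \<delta>] S(3) by (auto elim: eventually_mono)
  have gs: "(\<lambda>n. g (s n)) \<longlonglongrightarrow> c"
    using continuous_on_tendsto_compose[OF contg s0 _ evs] S(3) gc by simp
  have "(\<lambda>n. g (s n) - u n (s n)) \<longlonglongrightarrow> 0"
    by (rule Lim_null_comparison[OF eventually_mono[OF evs g] g0])
  from tendsto_diff[OF gs this] have us: "(\<lambda>n. u n (s n)) \<longlonglongrightarrow> c"
    by simp
  have key: "exp (A - B - D) * (x / y) = exp (- D) * (exp A * x / (exp B * y))" for A B D x y :: complex
    by (simp add: exp_diff exp_minus exp_add field_simps)
  have "(\<lambda>n. exp (of_nat n * L (s n) - of_nat n * L 0 - \<i> * of_real (\<theta> * \<mu> n / \<sigma> n))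
      * (u n (s n) / u n 0)) \<longlonglongrightarrow> exp (of_real (- \<theta>\<^sup>2 / 2)) * (c / c)"
    by (intro tendsto_intros E us u0)
  moreover have "exp (of_nat n * L (s n) - of_nat n * L 0 - \<i> * of_real (\<theta> * \<mu> n / \<sigma> n)) * (u n (s n) / u n 0)
    = exp (- \<i> * of_real (\<theta> * \<mu> n / \<sigma> n)) * (exp (of_nat n * L (s n)) * u n (s n) / (exp (of_nat n * L 0) * u n 0))" for n
    using key[of "of_nat n * L (s n)" "of_nat n * L 0" "\<i> * of_real (\<theta> * \<mu> n / \<sigma> n)"]
    by (simp only: mult_minus_left)
  ultimately show ?thesis
    using u0(2) by (simp only: s_def exp_of_real) simp
qed

section \<open>Arrays satisfying a linear recurrence\<close>

locale linear_array =
  fixes i0 j0 :: nat and t :: "nat \<Rightarrow> nat \<Rightarrow> real" and n0 :: int and p :: "int \<Rightarrow> int \<Rightarrow> real"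
  assumes i0: "i0 > 0"
    and rec: "\<And>n k. n \<ge> n0 \<Longrightarrow>
           p n k = (\<Sum>i=1..i0. \<Sum>j=0..j0. t i j * p (n - int i) (k - int j))"
    and zero: "\<And>n k. n < 0 \<or> k < 0 \<Longrightarrow> p n k = 0"
    and fin: "finite {(n, k). n < n0 \<and> p n k \<noteq> 0}"
begin

definition supp :: "int \<Rightarrow> int set" where "supp n = {k. p n k \<noteq> 0}"

text \<open>Rows below \<open>n0\<close> are finite by \<open>fin\<close>, and the support of a
  later row lies in finitely many shifts of supports of earlier rows. The induction measure is 0
  exactly on the rows below \<open>n0\<close>.\<close>

lemma finite_supp: "finite (supp n)"
proof (induction "nat (n - n0 + 1)" arbitrary: n rule: less_induct)
  case less
  show ?case
  proof (cases "n < n0")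
    case True
    then have "supp n \<subseteq> snd ` {(n, k). n < n0 \<and> p n k \<noteq> 0}"
      by (force simp: supp_def)
    then show ?thesis using fin finite_surj by blast
  next
    case False
    have "supp n \<subseteq> (\<Union>i\<in>{1..i0}. \<Union>j\<in>{0..j0}. (\<lambda>k. k + int j) ` supp (n - int i))"
    proof
      fix k assume "k \<in> supp n"
      then have "(\<Sum>i=1..i0. \<Sum>j=0..j0. t i j * p (n - int i) (k - int j)) \<noteq> 0"
        using rec[of n k] False by (simp add: supp_def)
      then obtain i j where "i \<in> {1..i0}" "j \<in> {0..j0}" "p (n - int i) (k - int j) \<noteq> 0"
        by (metis (no_types, lifting) mult_zero_right sum.neutral)
      then show "k \<in> (\<Union>i\<in>{1..i0}. \<Union>j\<in>{0..j0}. (\<lambda>k. k + int j) ` supp (n - int i))"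
        by (intro UN_I[of i] UN_I[of j] image_eqI[of _ _ "k - int j"]) (auto simp: supp_def)
    qed
    moreover have "finite (supp (n - int i))" if "i \<in> {1..i0}" for i
      using that False by (intro less) auto
    ultimately show ?thesis
      by (auto intro: finite_subset)
  qed
qed

section \<open>Generating functions of the rows\<close>

definition gen :: "int \<Rightarrow> complex \<Rightarrow> complex" where
  "gen n s = (\<Sum>k\<in>supp n. of_real (p n k) * exp (of_int k * s))"

definition coef :: "nat \<Rightarrow> complex \<Rightarrow> complex" where
  "coef i s = (\<Sum>j=0..j0. of_real (t i j) * exp (of_nat j * s))"

lemma gen_superset:
  assumes "finite K" "supp n \<subseteq> K"
  shows "gen n s = (\<Sum>k\<in>K. of_real (p n k) * exp (of_int k * s))"
  unfolding gen_def using assms by (intro sum.mono_neutral_left) (auto simp: supp_def)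

lemma gen_neg: "n < 0 \<Longrightarrow> gen n s = 0"
  by (simp add: gen_def zero)

lemma gen_holomorphic: "gen n holomorphic_on S"
  unfolding gen_def by (intro holomorphic_intros)

lemma coef_holomorphic: "coef i holomorphic_on S"
  unfolding coef_def by (intro holomorphic_intros)

text \<open>Summing the recurrence against \<open>exp (k * s)\<close> turns the shift of
  \<open>k\<close> by \<open>j\<close> into the factor \<open>exp (j * s)\<close>.\<close>

lemma gen_rec:
  assumes "n \<ge> n0"
  shows "gen n s = (\<Sum>i=1..i0. coef i s * gen (n - int i) s)"
proof -
  \<comment> \<open>One finite index set that contains all the shifted supports, so that the sums
    over \<open>k\<close> and over \<open>i\<close>, \<open>j\<close> can be interchanged.\<close>
  define K where "K = supp n \<union> (\<Union>i\<in>{1..i0}. \<Union>j\<in>{0..j0}. (\<lambda>k. k + int j) ` supp (n - int i))"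
  have K: "finite K"
    unfolding K_def by (auto simp: finite_supp)
  have shift: "(\<Sum>k\<in>K. of_real (p (n - int i) (k - int j)) * exp (of_int k * s))
      = exp (of_nat j * s) * gen (n - int i) s" if "i \<in> {1..i0}" "j \<in> {0..j0}" for i j
  proof -
    have "supp (n - int i) \<subseteq> (\<lambda>k. k - int j) ` K"
      using that by (force simp: K_def image_iff)
    then have "gen (n - int i) s
        = (\<Sum>k\<in>(\<lambda>k. k - int j) ` K. of_real (p (n - int i) k) * exp (of_int k * s))"
      using K by (intro gen_superset) auto
    also have "\<dots> = (\<Sum>k\<in>K. of_real (p (n - int i) (k - int j)) * exp (of_int (k - int j) * s))"
      by (subst sum.reindex) (auto simp: inj_on_def)
    finally have g: "gen (n - int i) s = \<dots>" .
    have e: "exp (of_int k * s) = exp (of_nat j * s) * exp (of_int (k - int j) * s)" for k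
      by (simp add: exp_add[symmetric] algebra_simps)
    show ?thesis
      unfolding g sum_distrib_left
      by (rule sum.cong[OF refl], subst e) (simp only: mult_ac)
  qed
  have "gen n s = (\<Sum>k\<in>K. of_real (p n k) * exp (of_int k * s))"
    using K by (intro gen_superset) (auto simp: K_def)
  also have "\<dots> = (\<Sum>k\<in>K. \<Sum>i=1..i0. \<Sum>j=0..j0.
      of_real (t i j) * (of_real (p (n - int i) (k - int j)) * exp (of_int k * s)))"
    by (simp add: rec[OF assms] sum_distrib_right mult.assoc)
  also have "\<dots> = (\<Sum>i=1..i0. \<Sum>j=0..j0. \<Sum>k\<in>K.
      of_real (t i j) * (of_real (p (n - int i) (k - int j)) * exp (of_int k * s)))"
    by (subst sum.swap, rule sum.cong[OF refl], rule sum.swap)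
  also have "\<dots> = (\<Sum>i=1..i0. \<Sum>j=0..j0. of_real (t i j) * (exp (of_nat j * s) * gen (n - int i) s))"
    by (simp add: sum_distrib_left[symmetric] shift)
  also have "\<dots> = (\<Sum>i=1..i0. coef i s * gen (n - int i) s)"
    by (simp add: coef_def sum_distrib_right mult.assoc)
  finally show ?thesis .
qed

text \<open>Rows of negative index vanish, which matches the cut-off at \<open>i \<le> n\<close>
  used for recurrences over the naturals.\<close>

lemma gen_nat_rec:
  assumes "n \<ge> nat n0"
  shows "gen (int n) s = (\<Sum>i=1..i0. coef i s * (if i \<le> n then gen (int (n - i)) s else 0))"
proof -
  have "gen (int n) s = (\<Sum>i=1..i0. coef i s * gen (int n - int i) s)"
    using assms by (intro gen_rec) linarith
  then show ?thesis
    by (auto simp: gen_neg of_nat_diff intro!: sum.cong)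
qed

lemma Omega_eq_sum: "Omega p n = (\<Sum>k\<in>supp (int n). p (int n) k)"
proof -
  have "Omega p n = (\<Sum>\<^sub>\<infinity>k\<in>supp (int n). p (int n) k)"
    unfolding Omega_def using zero by (intro infsum_cong_neutral) (force simp: supp_def)+
  then show ?thesis
    by (simp add: finite_supp)
qed

lemma gen_0: "gen (int n) 0 = of_real (Omega p n)"
  by (simp add: gen_def Omega_eq_sum)

lemma deriv_gen_0: "deriv (gen n) 0 = of_real (\<Sum>k\<in>supp n. p n k * of_int k)"
  and deriv2_gen_0: "deriv (deriv (gen n)) 0 = of_real (\<Sum>k\<in>supp n. p n k * (of_int k)\<^sup>2)"
proof -
  have "deriv (gen n) s = (\<Sum>k\<in>supp n. of_real (p n k) * of_int k * exp (of_int k * s))" for s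
    unfolding gen_def by (intro DERIV_imp_deriv DERIV_sum) (auto intro!: derivative_eq_intros)
  then have *: "deriv (gen n) = (\<lambda>s. \<Sum>k\<in>supp n. of_real (p n k) * of_int k * exp (of_int k * s))"
    by blast
  show "deriv (gen n) 0 = of_real (\<Sum>k\<in>supp n. p n k * of_int k)"
    by (simp add: *)
  have "deriv (deriv (gen n)) 0
      = (\<Sum>k\<in>supp n. of_real (p n k) * of_int k * of_int k * exp (of_int k * 0))"
    unfolding * by (intro DERIV_imp_deriv DERIV_sum) (auto intro!: derivative_eq_intros)
  then show "deriv (deriv (gen n)) 0 = of_real (\<Sum>k\<in>supp n. p n k * (of_int k)\<^sup>2)"
    by (simp add: power2_eq_square mult.assoc)
qed

end

section \<open>The dominant root and its exponent \<open>L\<close>\<close>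

locale max_root_array = linear_array +
  fixes l1 :: real
  assumes t_hat: "\<And>i. i \<in> {1..i0} \<Longrightarrow> t_hat j0 t i \<ge> 0"
    and max_root: "has_maximum_root (T_poly i0 j0 t) l1"
    and Omega: "Omega p \<in> \<Theta>(\<lambda>n. l1 ^ n)"
begin

lemma l1_pos: "l1 > 0"
  using max_root by (simp add: has_maximum_root_def)

lemma root: "(\<Sum>i=1..i0. t_hat j0 t i / l1 ^ i) = 1"
proof -
  have "l1 ^ i0 = (\<Sum>i=1..i0. t_hat j0 t i * l1 ^ (i0 - i))"
    using max_root by (simp add: has_maximum_root_def T_poly_def poly_sum poly_monom)
  also have "\<dots> = (\<Sum>i=1..i0. t_hat j0 t i / l1 ^ i) * l1 ^ i0"
    unfolding sum_distrib_right using l1_pos by (intro sum.cong) (auto simp: power_diff)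
  finally show ?thesis using l1_pos by simp
qed

text \<open>As \<open>i \<ge> 1\<close> and \<open>t_hat\<close> is nonnegative, the sum is at least
  the one in \<open>root\<close>, which is 1. It expresses simplicity of the root and is the common
  denominator of \<open>C_mu\<close> and \<open>C_sigma\<close>.\<close>

lemma denominator_pos: "(\<Sum>i=1..i0. real i * t_hat j0 t i / l1 ^ i) > 0"
proof -
  have "(\<Sum>i=1..i0. t_hat j0 t i / l1 ^ i) \<le> (\<Sum>i=1..i0. real i * t_hat j0 t i / l1 ^ i)"
    using t_hat l1_pos
    by (intro sum_mono divide_right_mono) (auto intro!: mult_right_mono[of 1 _ "t_hat _ _ _", simplified])
  then show ?thesis using root by simp
qed

lemma complex_roots:
  fixes z :: complex
  assumes "z ^ i0 - (\<Sum>i=1..i0. of_real (t_hat j0 t i) * z ^ (i0 - i)) = 0" "z \<noteq> of_real l1"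
  shows "norm z < l1"
proof -
  have "map_poly complex_of_real (T_poly i0 j0 t)
      = monom 1 i0 - (\<Sum>i=1..i0. monom (of_real (t_hat j0 t i)) (i0 - i))"
    by (rule poly_eqI) (auto simp: coeff_map_poly T_poly_def coeff_sum intro!: sum.cong)
  then have "poly (map_poly complex_of_real (T_poly i0 j0 t)) z = 0"
    using assms(1) by (simp add: poly_sum poly_monom)
  then show ?thesis
    using max_root assms(2) by (auto simp: has_maximum_root_def)
qed

lemma coef_0: "coef i 0 = of_real (t_hat j0 t i)"
  by (simp add: coef_def t_hat_def)

lemma sum_t_i: "(\<Sum>i=1..i0. \<Sum>j=0..j0. t i j * real i / l1 ^ i) = (\<Sum>i=1..i0. real i * t_hat j0 t i / l1 ^ i)"
  by (simp add: t_hat_def sum_distrib_left sum_distrib_right sum_divide_distrib mult_ac)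

text \<open>The implicit function theorem is applied to \<open>H = 1\<close> at the point (0, ln
  l1): there \<open>H = 1\<close> by \<open>root\<close>, and \<open>Hw\<close> is minus the
  positive denominator. Differentiating the equation then identifies the two derivatives of
  \<open>L\<close>.\<close>

lemma exponent_exists:
  obtains \<delta> L where "\<delta> > 0" "L holomorphic_on ball 0 \<delta>" "L 0 = of_real (ln l1)"
    "\<And>s. s \<in> ball 0 \<delta> \<Longrightarrow> (\<Sum>i=1..i0. coef i s / exp (L s) ^ i) = 1"
    "deriv L 0 = of_real (C_mu i0 j0 t l1)" "deriv (deriv L) 0 = of_real (C_sigma i0 j0 t l1)"
proof -
  define I where "I = {1..i0} \<times> {0..j0}"
  define c where "c q = complex_of_real (case q of (i, j) \<Rightarrow> t i j)" for q
  \<comment> \<open>With the logarithm of the root as second variable, every summand is the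
    exponential of a linear form.\<close>
  define H Hs Hw where "H x = (\<Sum>q\<in>I. c q * exp (of_nat (snd q) * fst x - of_nat (fst q) * snd x))"
    and "Hs x = (\<Sum>q\<in>I. c q * of_nat (snd q) * exp (of_nat (snd q) * fst x - of_nat (fst q) * snd x))"
    and "Hw x = - (\<Sum>q\<in>I. c q * of_nat (fst q) * exp (of_nat (snd q) * fst x - of_nat (fst q) * snd x))"
    for x :: "complex \<times> complex"
  define w0 where "w0 = complex_of_real (ln l1)"
  have e: "exp (- (of_nat i * w0)) = of_real (1 / l1 ^ i)" for i
  proof -
    have "exp w0 = of_real l1"
      using l1_pos by (simp add: w0_def exp_of_real)
    then show ?thesis
      by (simp add: exp_minus exp_of_nat_mult divide_inverse)
  qed
  have H_coef: "H (s, w) = (\<Sum>i=1..i0. coef i s / exp w ^ i)" for s w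
    by (simp add: H_def I_def c_def coef_def exp_diff exp_of_nat_mult sum_divide_distrib
        sum.cartesian_product split_def)
  have H0: "H (0, w0) = 1"
    unfolding H_coef using arg_cong[OF root, of complex_of_real] l1_pos
    by (simp add: coef_0 w0_def exp_of_real)
  have "Hw (0, w0) = - of_real (\<Sum>q\<in>I. (case q of (i, j) \<Rightarrow> t i j) * real (fst q) / l1 ^ fst q)"
    by (simp add: Hw_def c_def e)
  also have "(\<Sum>q\<in>I. (case q of (i, j) \<Rightarrow> t i j) * real (fst q) / l1 ^ fst q)
      = (\<Sum>i=1..i0. \<Sum>j=0..j0. t i j * real i / l1 ^ i)"
    by (simp add: I_def sum.cartesian_product split_def)
  finally have Hw0: "Hw (0, w0) \<noteq> 0"
    using denominator_pos by (simp only: sum_t_i neg_equal_0_iff_equal of_real_eq_0_iff)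
  have "(H has_derivative (\<lambda>v. Hs x * fst v + Hw x * snd v)) (at x)" for x
  proof -
    have E: "((\<lambda>x. exp (of_nat b * fst x - of_nat a * snd x)) has_derivative
        (\<lambda>v. exp (of_nat b * fst x - of_nat a * snd x) * (of_nat b * fst v - of_nat a * snd v))) (at x)"
      for a b
      by (rule has_derivative_compose[OF _ DERIV_exp[unfolded has_field_derivative_def]])
         (auto intro!: derivative_eq_intros)
    have "(H has_derivative (\<lambda>v. \<Sum>q\<in>I. c q * (exp (of_nat (snd q) * fst x - of_nat (fst q) * snd x)
        * (of_nat (snd q) * fst v - of_nat (fst q) * snd v)))) (at x)"
      unfolding H_def by (intro has_derivative_sum has_derivative_mult_right E)
    then show ?thesis
      by (simp add: Hs_def Hw_def algebra_simps sum_distrib_left sum_subtractf)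
  qed
  moreover have "continuous_on UNIV Hs" "continuous_on UNIV Hw"
    unfolding Hs_def Hw_def by (intro continuous_intros)+
  ultimately obtain \<delta> L where \<delta>: "\<delta> > 0" and L: "L holomorphic_on ball 0 \<delta>" "L 0 = w0"
    and HL: "\<And>s. s \<in> ball 0 \<delta> \<Longrightarrow> H (s, L s) = 1"
    using complex_implicit_function[of H Hs Hw 0 w0] Hw0 H0 by metis
  have eq: "(\<Sum>q\<in>I. c q * exp (of_nat (snd q) * s - of_nat (fst q) * L s)) = 1"
    if "s \<in> ball 0 \<delta>" for s
    using HL[OF that] by (simp add: H_def)
  define Den where "Den = (\<Sum>i=1..i0. \<Sum>j=0..j0. t i j * real i / l1 ^ i)"
  have "Den \<noteq> 0"
    using denominator_pos unfolding Den_def sum_t_i by linarith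
  moreover have "(\<Sum>q\<in>I. (case q of (i, j) \<Rightarrow> t i j) * real (fst q) / l1 ^ fst q) = Den"
    by (simp add: Den_def I_def sum.cartesian_product split_def)
  ultimately have Den: "Den \<noteq> 0"
    "(\<Sum>q\<in>I. (case q of (i, j) \<Rightarrow> t i j) * real (fst q) / l1 ^ fst q) = Den" .
  define Cm where "Cm = C_mu i0 j0 t l1"
  have Cm: "(\<Sum>q\<in>I. (case q of (i, j) \<Rightarrow> t i j) * real (snd q) / l1 ^ fst q) = Cm * Den"
  proof -
    have "Cm = (\<Sum>q\<in>I. (case q of (i, j) \<Rightarrow> t i j) * real (snd q) / l1 ^ fst q) / Den"
      unfolding Cm_def C_mu_def Den_def by (simp add: I_def sum.cartesian_product split_def)
    then show ?thesis using Den(1) by simp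
  qed
  define Cs where "Cs = C_sigma i0 j0 t l1"
  have Cs: "(\<Sum>q\<in>I. (case q of (i, j) \<Rightarrow> t i j) / l1 ^ fst q * (real (snd q) - Cm * real (fst q))\<^sup>2) = Cs * Den"
  proof -
    have "Cs = (\<Sum>q\<in>I. (case q of (i, j) \<Rightarrow> t i j) / l1 ^ fst q * (real (snd q) - Cm * real (fst q))\<^sup>2) / Den"
      unfolding Cs_def C_sigma_def Den_def Cm_def by (simp add: I_def sum.cartesian_product split_def)
    then show ?thesis using Den(1) by simp
  qed
  note D = implicit_exponent_derivs[OF open_ball _ L(1) eq, simplified L(2) mult_minus_left e c_def]
  have "(\<Sum>q\<in>I. of_real (case q of (i, j) \<Rightarrow> t i j) * complex_of_real (1 / l1 ^ fst q) * (of_nat (snd q) - of_nat (fst q) * deriv L 0)) = 0"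
    using D(1) \<delta> by simp
  \<comment> \<open>Isolating the unknown gives \<open>Cm * Den = deriv L 0 * Den\<close>; the
    second derivative is found from \<open>Cs * Den\<close> in the same way.\<close>
  then have "complex_of_real (\<Sum>q\<in>I. (case q of (i, j) \<Rightarrow> t i j) * real (snd q) / l1 ^ fst q)
      = deriv L 0 * of_real (\<Sum>q\<in>I. (case q of (i, j) \<Rightarrow> t i j) * real (fst q) / l1 ^ fst q)"
    by (simp add: right_diff_distrib sum_subtractf sum_distrib_left mult_ac)
  then have d1: "deriv L 0 = of_real Cm"
    using Den(1) unfolding Cm Den(2) by simp
  have "(\<Sum>q\<in>I. of_real (case q of (i, j) \<Rightarrow> t i j) * complex_of_real (1 / l1 ^ fst q) *
      ((of_nat (snd q) - of_nat (fst q) * deriv L 0)\<^sup>2 - of_nat (fst q) * deriv (deriv L) 0)) = 0"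
    using D(2) \<delta> by simp
  then have "complex_of_real (\<Sum>q\<in>I. (case q of (i, j) \<Rightarrow> t i j) / l1 ^ fst q * (real (snd q) - Cm * real (fst q))\<^sup>2)
      = deriv (deriv L) 0 * of_real (\<Sum>q\<in>I. (case q of (i, j) \<Rightarrow> t i j) * real (fst q) / l1 ^ fst q)"
    by (simp add: d1 right_diff_distrib sum_subtractf sum_distrib_left mult_ac)
  then have d2: "deriv (deriv L) 0 = of_real Cs"
    using Den(1) unfolding Cs Den(2) by simp
  show thesis
    using that[OF \<delta> L(1)] L(2) HL d1 d2 by (simp add: H_coef w0_def Cm_def Cs_def)
qed

end

section \<open>Asymptotics of moments and characteristic functions\<close>

context max_root_array
begin

text \<open>A finite sum over the row, independent of any probability space; it is
  \<open>F' / F\<close> at 0 for \<open>F = gen n\<close>.\<close>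

definition mean :: "nat \<Rightarrow> real" where
  "mean n = (\<Sum>k\<in>supp (int n). p (int n) k * of_int k) / Omega p n"

text \<open>Second moment minus squared mean, the form in which the second logarithmic derivative of
  \<open>gen\<close> at 0 appears.\<close>

definition var :: "nat \<Rightarrow> real" where
  "var n = (\<Sum>k\<in>supp (int n). p (int n) k * (of_int k)\<^sup>2) / Omega p n - (mean n)\<^sup>2"

text \<open>With \<open>u n = gen n / exp L ^ n\<close>, the values and first two derivatives of
  \<open>u n\<close> at 0 converge geometrically to \<open>c0\<close>, \<open>c1\<close>,
  \<open>c2\<close>. Logarithmic differentiation gives the moments, and imaginary arguments give the
  characteristic functions.\<close>

lemma moments_and_char_asymptotics:
  assumes C\<sigma>: "C_sigma i0 j0 t l1 > 0"
  shows "eventually (\<lambda>n. Omega p n \<noteq> 0) sequentially"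
    and "\<exists>d_mu d_sigma \<gamma>. \<gamma> \<in> {0<..<1} \<and>
            (\<lambda>n. mean n - (C_mu i0 j0 t l1 * real n + d_mu)) \<in> O(\<lambda>n. \<gamma> ^ n) \<and>
            (\<lambda>n. var n - (C_sigma i0 j0 t l1 * real n + d_sigma)) \<in> O(\<lambda>n. \<gamma> ^ n)"
    and "eventually (\<lambda>n. \<mu> n = mean n) sequentially \<Longrightarrow>
         eventually (\<lambda>n. (\<sigma> n)\<^sup>2 = var n) sequentially \<Longrightarrow> (\<And>n. \<sigma> n \<ge> 0) \<Longrightarrow>
         (\<lambda>n. exp (- \<i> * of_real (\<theta> * \<mu> n / \<sigma> n)) *
            (gen (int n) (\<i> * of_real (\<theta> / \<sigma> n)) / of_real (Omega p n)))
         \<longlonglongrightarrow> of_real (exp (- (\<theta>\<^sup>2) / 2))"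
proof -
  define Cm where "Cm = C_mu i0 j0 t l1"
  define Cs where "Cs = C_sigma i0 j0 t l1"
  have Cs: "Cs > 0" using C\<sigma> by (simp add: Cs_def)
  obtain \<delta>0 L where \<delta>0: "\<delta>0 > 0" and L: "L holomorphic_on ball 0 \<delta>0" "L 0 = of_real (ln l1)"
    and eq: "\<And>s. s \<in> ball 0 \<delta>0 \<Longrightarrow> (\<Sum>i=1..i0. coef i s / exp (L s) ^ i) = 1"
    and d1: "deriv L 0 = of_real Cm" and d2: "deriv (deriv L) 0 = of_real Cs"
    by (rule exponent_exists[folded Cm_def Cs_def], rule that)
  define S where "S = ball (0::complex) \<delta>0"
  have S: "open S" "0 \<in> S" using \<delta>0 by (auto simp: S_def)
  have Lhol: "L holomorphic_on S" using L by (simp add: S_def)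
  define u where "u n s = gen (int n) s / exp (L s) ^ n" for n s
  have l0: "exp (L 0) = of_real l1"
    using l1_pos by (simp add: L exp_of_real)
  have uhol: "u n holomorphic_on S" for n
    unfolding u_def by (intro holomorphic_intros gen_holomorphic Lhol) auto
  have genu: "gen (int n) s = exp (of_nat n * L s) * u n s" for n s
    by (simp add: u_def exp_of_nat_mult)
  obtain \<delta> \<gamma> C where \<delta>: "\<delta> > 0" "cball 0 \<delta> \<subseteq> S" and \<gamma>: "0 < \<gamma>" "\<gamma> < 1"
    and inc: "\<And>s n. s \<in> cball 0 \<delta> \<Longrightarrow> norm (u (Suc n) s - u n s) \<le> C * \<gamma> ^ n"
    unfolding u_def
  proof (rule quasi_power_convergence[OF i0 S, of coef "\<lambda>n. gen (int n)" "\<lambda>s. exp (L s)" "nat n0"])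
    \<comment> \<open>Dominance is only required at \<open>s = 0\<close>, where the coefficients are
      the \<open>t_hat\<close> and the root is \<open>l1\<close>.\<close>
    fix x :: complex assume "norm x \<le> 1 / norm (exp (L 0))"
    then have x: "norm x \<le> 1 / l1"
      using l1_pos by (simp add: l0)
    show "(\<Sum>i<i0. deflate (\<lambda>i. coef i 0) (exp (L 0)) i * x ^ i) \<noteq> 0"
      unfolding coef_0 l0
      by (rule deflate_dominant_root_nonzero[OF i0 l1_pos root _ complex_roots x])
         (use denominator_pos in auto)
  qed (use coef_holomorphic gen_holomorphic Lhol eq gen_nat_rec in
       \<open>auto simp: S_def intro!: holomorphic_on_imp_continuous_on holomorphic_on_exp' continuous_intros\<close>)
  note geom = higher_deriv_geometric_limit[OF S(1) \<delta>(2,1) uhol inc \<gamma>]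
  obtain c0 where c0: "(\<lambda>n. u n 0 - c0) \<in> O(\<lambda>n. of_real (\<gamma> ^ n))"
    using geom[of 0] by auto
  obtain c1 where c1: "(\<lambda>n. deriv (u n) 0 - c1) \<in> O(\<lambda>n. of_real (\<gamma> ^ n))"
    using geom[of 1] by auto
  obtain c2 where c2: "(\<lambda>n. deriv (deriv (u n)) 0 - c2) \<in> O(\<lambda>n. of_real (\<gamma> ^ n))"
    using geom[of 2] by (auto simp: eval_nat_numeral)
  have u0: "(\<lambda>n. u n 0) \<longlonglongrightarrow> c0"
    by (rule bigo_geometric_imp_tendsto[OF c0 \<gamma>])
  have u0_eq: "u n 0 = of_real (Omega p n / l1 ^ n)" for n
    by (simp add: u_def l0 gen_0)
  \<comment> \<open>The lower half of the \<open>\<Theta>\<close> hypothesis keeps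
    \<open>u n 0\<close> away from 0, so its limit \<open>c0\<close> is nonzero and division by it
    is possible.\<close>
  have "(\<lambda>n. l1 ^ n) \<in> O(Omega p)"
    using Omega by (auto simp: bigtheta_def bigomega_iff_bigo)
  then obtain K where K: "K > 0" "eventually (\<lambda>n. norm (l1 ^ n) \<le> K * norm (Omega p n)) sequentially"
    by (elim landau_o.bigE)
  have lower: "eventually (\<lambda>n. norm (u n 0) \<ge> 1 / K) sequentially"
    using K(2) by eventually_elim
      (use l1_pos K(1) in \<open>simp add: u0_eq norm_divide norm_power field_simps\<close>)
  have c0_nz: "c0 \<noteq> 0"
  proof -
    have "norm c0 \<ge> 1 / K"
      using tendsto_lowerbound[OF tendsto_norm[OF u0] lower] by simp
    then show ?thesis using K(1) by auto
  qed
  show Om: "eventually (\<lambda>n. Omega p n \<noteq> 0) sequentially"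
    using lower by eventually_elim (use K(1) in \<open>auto simp: u0_eq\<close>)
  define r where "r n = deriv (u n) 0 / u n 0" for n
  have r: "(\<lambda>n. r n - c1 / c0) \<in> O(\<lambda>n. of_real (\<gamma> ^ n))"
    unfolding r_def by (rule bigo_geometric_divide[OF c1 c0 u0 c0_nz])
  have r2: "(\<lambda>n. (r n)\<^sup>2 - (c1 / c0)\<^sup>2) \<in> O(\<lambda>n. of_real (\<gamma> ^ n))"
    by (rule bigo_square_diff[OF r bigo_geometric_imp_tendsto[OF r \<gamma>]])
  have q: "(\<lambda>n. deriv (deriv (u n)) 0 / u n 0 - c2 / c0) \<in> O(\<lambda>n. of_real (\<gamma> ^ n))"
    by (rule bigo_geometric_divide[OF c2 c0 u0 c0_nz])
  have mean_eq: "complex_of_real (mean n) = of_nat n * of_real Cm + r n"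
    and var_eq: "complex_of_real (var n) = of_nat n * of_real Cs + (deriv (deriv (u n)) 0 / u n 0 - (r n)\<^sup>2)"
    if "Omega p n \<noteq> 0" for n
  proof -
    have "u n 0 \<noteq> 0" using that l1_pos by (simp add: u0_eq)
    note D = exp_mult_log_derivs[OF S Lhol uhol genu this]
    show "complex_of_real (mean n) = of_nat n * of_real Cm + r n"
      using D(1) by (simp add: deriv_gen_0 gen_0 mean_def r_def d1)
    show "complex_of_real (var n) = of_nat n * of_real Cs + (deriv (deriv (u n)) 0 / u n 0 - (r n)\<^sup>2)"
      using D(2) by (simp add: deriv_gen_0 deriv2_gen_0 gen_0 mean_def var_def r_def d2)
  qed
  have mean_O: "(\<lambda>n. mean n - (Cm * real n + Re (c1 / c0))) \<in> O(\<lambda>n. \<gamma> ^ n)"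
  proof (rule bigo_Re[OF r])
    show "eventually (\<lambda>n. mean n - (Cm * real n + Re (c1 / c0)) = Re (r n - c1 / c0)) sequentially"
      using Om
    proof eventually_elim
      case (elim n)
      have "mean n = Re (complex_of_real (mean n))" by simp
      also have "\<dots> = real n * Cm + Re (r n)" unfolding mean_eq[OF elim] by simp
      finally show ?case by simp
    qed
  qed
  \<comment> \<open>The limit of the second logarithmic derivative of \<open>u n\<close> at 0; its
    real part serves as \<open>d_sigma\<close>.\<close>
  define ds where "ds = c2 / c0 - (c1 / c0)\<^sup>2"
  have "(\<lambda>n. (deriv (deriv (u n)) 0 / u n 0 - c2 / c0) - ((r n)\<^sup>2 - (c1 / c0)\<^sup>2)) \<in> O(\<lambda>n. of_real (\<gamma> ^ n))"
    by (intro sum_in_bigo q r2)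
  then have var_O: "(\<lambda>n. var n - (Cs * real n + Re ds)) \<in> O(\<lambda>n. \<gamma> ^ n)"
  proof (rule bigo_Re)
    show "eventually (\<lambda>n. var n - (Cs * real n + Re ds)
        = Re ((deriv (deriv (u n)) 0 / u n 0 - c2 / c0) - ((r n)\<^sup>2 - (c1 / c0)\<^sup>2))) sequentially"
      using Om
    proof eventually_elim
      case (elim n)
      have "var n = Re (complex_of_real (var n))" by simp
      also have "\<dots> = real n * Cs + Re (deriv (deriv (u n)) 0 / u n 0 - (r n)\<^sup>2)"
        unfolding var_eq[OF elim] by simp
      finally show ?case by (simp add: ds_def)
    qed
  qed
  show "\<exists>d_mu d_sigma \<gamma>. \<gamma> \<in> {0<..<1} \<and>
            (\<lambda>n. mean n - (C_mu i0 j0 t l1 * real n + d_mu)) \<in> O(\<lambda>n. \<gamma> ^ n) \<and>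
            (\<lambda>n. var n - (C_sigma i0 j0 t l1 * real n + d_sigma)) \<in> O(\<lambda>n. \<gamma> ^ n)"
    using mean_O var_O \<gamma> unfolding Cm_def Cs_def by (intro exI conjI) auto
  \<comment> \<open>Weakens the geometric error to a bounded one, the form required by
    \<open>quasi_power_char_tendsto\<close>.\<close>
  have bounded: "(\<lambda>n. x n - a * real n) \<in> O(\<lambda>_. 1)"
    if "(\<lambda>n. y n - (a * real n + d)) \<in> O(\<lambda>n. \<gamma> ^ n)" "eventually (\<lambda>n. x n = y n) sequentially"
    for x y :: "nat \<Rightarrow> real" and a d
  proof -
    have "(\<lambda>n. \<gamma> ^ n) \<in> O(\<lambda>_. 1 :: real)"
      using \<gamma> by (intro bigoI[of _ 1] always_eventually) (auto intro: power_le_one)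
    with that(1) have "(\<lambda>n. y n - (a * real n + d)) \<in> O(\<lambda>_. 1)"
      by (rule landau_o.big_trans)
    then have "(\<lambda>n. (y n - (a * real n + d)) + d) \<in> O(\<lambda>_. 1)"
      by (rule sum_in_bigo(1)) auto
    moreover have "eventually (\<lambda>n. (y n - (a * real n + d)) + d = x n - a * real n) sequentially"
      using that(2) by eventually_elim simp
    ultimately show ?thesis
      by (simp only: landau_o.big.in_cong)
  qed
  assume \<mu>: "eventually (\<lambda>n. \<mu> n = mean n) sequentially"
    and \<sigma>: "eventually (\<lambda>n. (\<sigma> n)\<^sup>2 = var n) sequentially" "\<And>n. \<sigma> n \<ge> 0"
  have "(\<lambda>n. exp (- \<i> * of_real (\<theta> * \<mu> n / \<sigma> n)) *
      (exp (of_nat n * L (\<i> * of_real (\<theta> / \<sigma> n))) * u n (\<i> * of_real (\<theta> / \<sigma> n)) /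
        (exp (of_nat n * L 0) * u n 0))) \<longlonglongrightarrow> of_real (exp (- (\<theta>\<^sup>2) / 2))"
    by (rule quasi_power_char_tendsto[where u = u, OF S(1) \<delta>(2,1) Lhol
          holomorphic_on_imp_continuous_on[OF uhol] inc \<gamma> u0 c0_nz d1 d2 Cs
          bounded[OF mean_O \<mu>] bounded[OF var_O \<sigma>(1)] \<sigma>(2)])
  then show "(\<lambda>n. exp (- \<i> * of_real (\<theta> * \<mu> n / \<sigma> n)) *
            (gen (int n) (\<i> * of_real (\<theta> / \<sigma> n)) / of_real (Omega p n)))
         \<longlonglongrightarrow> of_real (exp (- (\<theta>\<^sup>2) / 2))"
    by (simp only: genu[symmetric] gen_0)
qed

end

section \<open>The limit theorem\<close>

text \<open>The finitely many probabilities add up to 1, so \<open>X\<close> lies almost surely in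
  \<open>A\<close> and \<open>f (X \<omega>)\<close> agrees almost everywhere with a simple
  function. The general codomain covers real moments as well as complex characteristic
  functions.\<close>

lemma (in prob_space) integral_finite_int_valued:
  fixes X :: "'a \<Rightarrow> real" and f :: "real \<Rightarrow> 'b::{banach, second_countable_topology}"
  assumes X: "X \<in> borel_measurable M" and f: "f \<in> borel_measurable borel" and A: "finite A"
    and q: "\<And>k. k \<in> A \<Longrightarrow> \<P>(\<omega> in M. X \<omega> = of_int k) = q k" and one: "(\<Sum>k\<in>A. q k) = 1"
  shows "(\<integral>\<omega>. f (X \<omega>) \<partial>M) = (\<Sum>k\<in>A. q k *\<^sub>R f (of_int k))"
proof -
  define E where "E k = {\<omega>\<in>space M. X \<omega> = of_int k}" for k :: int
  have E [measurable]: "E k \<in> events" for k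
    unfolding E_def using X by measurable
  have "prob (\<Union>k\<in>A. E k) = (\<Sum>k\<in>A. prob (E k))"
  proof (rule finite_measure_finite_Union[OF A])
    show "disjoint_family_on E A" by (auto simp: disjoint_family_on_def E_def)
  qed auto
  also have "\<dots> = 1"
    using one q by (simp add: E_def)
  finally have ae: "AE \<omega> in M. \<omega> \<in> (\<Union>k\<in>A. E k)"
    using A by (subst (asm) prob_eq_1) auto
  have "(\<integral>\<omega>. f (X \<omega>) \<partial>M) = (\<integral>\<omega>. (\<Sum>k\<in>A. indicator (E k) \<omega> *\<^sub>R f (of_int k)) \<partial>M)"
  proof (rule integral_cong_AE)
    show "(\<lambda>\<omega>. f (X \<omega>)) \<in> borel_measurable M"
      using X f by measurable
    show "AE \<omega> in M. f (X \<omega>) = (\<Sum>k\<in>A. indicator (E k) \<omega> *\<^sub>R f (of_int k))"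
      using ae
    proof eventually_elim
      case (elim \<omega>)
      then obtain k where k: "k \<in> A" "\<omega> \<in> E k" by blast
      then have "(\<Sum>k'\<in>A. indicator (E k') \<omega> *\<^sub>R f (of_int k')) = (\<Sum>k'\<in>A. if k' = k then f (of_int k) else 0)"
        by (intro sum.cong) (auto simp: E_def indicator_def)
      with k A show ?case by (simp add: E_def)
    qed
  qed simp
  also have "\<dots> = (\<Sum>k\<in>A. prob (E k) *\<^sub>R f (of_int k))"
    by (subst Bochner_Integration.integral_sum) (auto simp: emeasure_eq_measure)
  also have "\<dots> = (\<Sum>k\<in>A. q k *\<^sub>R f (of_int k))"
    using q by (simp add: E_def)
  finally show ?thesis .
qed

text \<open>For all large \<open>n\<close> the total of the row is nonzero, and expectations become
  the finite sums \<open>mean\<close>, \<open>var\<close> and \<open>gen\<close>. The asymptotics of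
  these give the moments, and with Levy's theorem the weak limit.\<close>

theorem theorem2p6:
  fixes i0 j0 :: nat
    and t :: "nat \<Rightarrow> nat \<Rightarrow> real"
    and lambda1 :: real
    and n0 :: int
    and p :: "int \<Rightarrow> int \<Rightarrow> real"
    and M :: "nat \<Rightarrow> 'a measure"
    and X :: "nat \<Rightarrow> 'a \<Rightarrow> real"
    and \<mu> \<sigma> :: "nat \<Rightarrow> real"
  assumes "i0 > 0" and "j0 > 0"
    and "\<And>i. i \<in> {1..i0} \<Longrightarrow> t_hat j0 t i \<ge> 0"
    and "has_maximum_root (T_poly i0 j0 t) lambda1"
    and "\<And>n k. n \<ge> n0 \<Longrightarrow>
           p n k = (\<Sum>i=1..i0. \<Sum>j=0..j0. t i j * p (n - int i) (k - int j))"
    and "\<And>n k. p n k \<ge> 0"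
    and "\<And>n k. n < 0 \<or> k < 0 \<Longrightarrow> p n k = 0"
    and "finite {(n, k). n < n0 \<and> p n k \<noteq> 0}"
    and "Omega p \<in> \<Theta>(\<lambda>n. lambda1 ^ n)"
    \<comment> \<open>\<open>Omega p n\<close> may vanish for finitely many \<open>n\<close>; for these \<open>X n\<close> is unconstrained.\<close>
    and "\<And>n. Omega p n \<noteq> 0 \<Longrightarrow> prob_space (M n)"
    and "\<And>n. Omega p n \<noteq> 0 \<Longrightarrow> X n \<in> borel_measurable (M n)"
    and "\<And>n k. Omega p n \<noteq> 0 \<Longrightarrow>
           \<P>(\<omega> in M n. X n \<omega> = of_int k) = p (int n) k / Omega p n"
    and "\<And>n. \<mu> n = prob_space.expectation (M n) (X n)"
    and "\<And>n. \<sigma> n = sqrt (prob_space.variance (M n) (X n))"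
    and "C_sigma i0 j0 t lambda1 > 0"
  shows "(\<exists>d_mu d_sigma gamma_mu gamma_sigma :: real.
            gamma_mu \<in> {0<..<1} \<and> gamma_sigma \<in> {0<..<1} \<and>
            (\<lambda>n. \<mu> n - (C_mu i0 j0 t lambda1 * real n + d_mu)) \<in> O(\<lambda>n. gamma_mu ^ n) \<and>
            (\<lambda>n. (\<sigma> n)\<^sup>2 - (C_sigma i0 j0 t lambda1 * real n + d_sigma)) \<in> O(\<lambda>n. gamma_sigma ^ n)) \<and>
         weak_conv_m (\<lambda>n. distr (M n) borel (\<lambda>\<omega>. (X n \<omega> - \<mu> n) / \<sigma> n)) std_normal_distribution"
proof -
  interpret max_root_array i0 j0 t n0 p lambda1
    by unfold_locales (fact assms)+
  let ?O = "Omega p"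
  have one: "(\<Sum>k\<in>supp (int n). p (int n) k / ?O n) = 1" if "?O n \<noteq> 0" for n
    using that by (simp add: Omega_eq_sum flip: sum_divide_distrib)
  have int: "integral\<^sup>L (M n) (\<lambda>\<omega>. f (X n \<omega>)) = (\<Sum>k\<in>supp (int n). (p (int n) k / ?O n) *\<^sub>R f (of_int k))"
    if "?O n \<noteq> 0" "f \<in> borel_measurable borel" for n and f :: "real \<Rightarrow> 'b::{banach, second_countable_topology}"
    using assms(10-12)[OF that(1)] one[OF that(1)] that(2)
    by (intro prob_space.integral_finite_int_valued finite_supp) auto
  have \<mu>: "\<mu> n = mean n" if "?O n \<noteq> 0" for n
    using int[OF that, of "\<lambda>x. x"] by (simp add: assms(13) mean_def sum_divide_distrib)
  \<comment> \<open>An integral of a square is nonnegative for any measure, so squaring the root is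
    correct also where \<open>Omega p n = 0\<close>.\<close>
  have \<sigma>2: "(\<sigma> n)\<^sup>2 = integral\<^sup>L (M n) (\<lambda>\<omega>. (X n \<omega> - \<mu> n)\<^sup>2)" for n
    by (simp add: assms(13,14))
  have \<sigma>: "(\<sigma> n)\<^sup>2 = var n" if n: "?O n \<noteq> 0" for n
  proof -
    have "(\<sigma> n)\<^sup>2 = (\<Sum>k\<in>supp (int n). p (int n) k / ?O n * (of_int k - mean n)\<^sup>2)"
      using int[OF n, of "\<lambda>x. (x - mean n)\<^sup>2"] by (simp add: \<sigma>2 \<mu>[OF n])
    also have "\<dots> = (\<Sum>k\<in>supp (int n). p (int n) k * (of_int k)\<^sup>2 / ?O n
        - 2 * mean n * (p (int n) k * of_int k / ?O n) + (mean n)\<^sup>2 * (p (int n) k / ?O n))"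
      by (intro sum.cong refl) (simp add: power2_diff algebra_simps add_divide_distrib diff_divide_distrib)
    also have "\<dots> = (\<Sum>k\<in>supp (int n). p (int n) k * (of_int k)\<^sup>2) / ?O n
        - 2 * mean n * mean n + (mean n)\<^sup>2 * 1"
      by (simp only: sum.distrib sum_subtractf sum_distrib_left[symmetric] one[OF n, folded sum_divide_distrib]
          sum_divide_distrib[symmetric] mean_def[symmetric])
    finally show ?thesis
      by (simp add: var_def power2_eq_square)
  qed
  have \<sigma>_nonneg: "\<sigma> n \<ge> 0" for n
    by (simp add: assms(14))
  note ev = moments_and_char_asymptotics(1)[OF assms(15)]
  have ev\<mu>: "eventually (\<lambda>n. \<mu> n = mean n) sequentially"
    and ev\<sigma>: "eventually (\<lambda>n. (\<sigma> n)\<^sup>2 = var n) sequentially"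
    using ev by (auto elim!: eventually_mono intro: \<mu> \<sigma>)
  obtain d_mu d_sigma \<gamma> where \<gamma>: "\<gamma> \<in> {0<..<1}"
    and m: "(\<lambda>n. mean n - (C_mu i0 j0 t lambda1 * real n + d_mu)) \<in> O(\<lambda>n. \<gamma> ^ n)"
    and v: "(\<lambda>n. var n - (C_sigma i0 j0 t lambda1 * real n + d_sigma)) \<in> O(\<lambda>n. \<gamma> ^ n)"
    using moments_and_char_asymptotics(2)[OF assms(15)] by blast
  have "(\<lambda>n. \<mu> n - (C_mu i0 j0 t lambda1 * real n + d_mu)) \<in> O(\<lambda>n. \<gamma> ^ n)"
    using m by (rule landau_o.big.in_cong[THEN iffD2, rotated])
      (use ev\<mu> in \<open>auto elim!: eventually_mono\<close>)
  moreover have "(\<lambda>n. (\<sigma> n)\<^sup>2 - (C_sigma i0 j0 t lambda1 * real n + d_sigma)) \<in> O(\<lambda>n. \<gamma> ^ n)"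
    using v by (rule landau_o.big.in_cong[THEN iffD2, rotated])
      (use ev\<sigma> in \<open>auto elim!: eventually_mono\<close>)
  moreover have "weak_conv_m (\<lambda>n. distr (M n) borel (\<lambda>\<omega>. (X n \<omega> - \<mu> n) / \<sigma> n)) std_normal_distribution"
  proof -
    let ?D = "\<lambda>n. distr (M n) borel (\<lambda>\<omega>. (X n \<omega> - \<mu> n) / \<sigma> n)"
    \<comment> \<open>For the finitely many \<open>n\<close> with \<open>Omega p n = 0\<close>, \<open>?D n\<close> need not be a distribution.\<close>
    define D where "D n = (if ?O n = 0 then std_normal_distribution else ?D n)" for n
    have "weak_conv_m D std_normal_distribution"
    proof (rule levy_continuity)
      show "real_distribution std_normal_distribution"
        by (rule real_dist_normal_dist)
      show "real_distribution (D n)" for n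
        using assms(10,11)[of n] real_dist_normal_dist
        by (auto simp: D_def intro!: prob_space.real_distribution_distr)
      fix \<theta>
      \<comment> \<open>The centring contributes the factor in front; the rescaled variable
        evaluates \<open>gen\<close> on the imaginary axis.\<close>
      have "char (D n) \<theta> = exp (- \<i> * of_real (\<theta> * \<mu> n / \<sigma> n)) *
            (gen (int n) (\<i> * of_real (\<theta> / \<sigma> n)) / of_real (?O n))" if n: "?O n \<noteq> 0" for n
      proof -
        have "char (D n) \<theta> = integral\<^sup>L (M n) (\<lambda>\<omega>. iexp (\<theta> * ((X n \<omega> - \<mu> n) / \<sigma> n)))"
          using n assms(11)[OF n] by (simp add: D_def char_def integral_distr)
        also have "\<dots> = (\<Sum>k\<in>supp (int n). (p (int n) k / ?O n) *\<^sub>R iexp (\<theta> * ((of_int k - \<mu> n) / \<sigma> n)))"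
          using int[OF n, of "\<lambda>x. iexp (\<theta> * ((x - \<mu> n) / \<sigma> n))"] by simp
        also have "\<dots> = (\<Sum>k\<in>supp (int n). exp (- \<i> * of_real (\<theta> * \<mu> n / \<sigma> n)) *
            (of_real (p (int n) k) * exp (of_int k * (\<i> * of_real (\<theta> / \<sigma> n))) / of_real (?O n)))"
        proof (intro sum.cong refl)
          fix k
          have "iexp (\<theta> * ((of_int k - \<mu> n) / \<sigma> n))
              = exp (- \<i> * of_real (\<theta> * \<mu> n / \<sigma> n)) * exp (of_int k * (\<i> * of_real (\<theta> / \<sigma> n)))"
            unfolding exp_add[symmetric] by (simp add: diff_divide_distrib algebra_simps)
          then show "(p (int n) k / ?O n) *\<^sub>R iexp (\<theta> * ((of_int k - \<mu> n) / \<sigma> n))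
              = exp (- \<i> * of_real (\<theta> * \<mu> n / \<sigma> n)) *
            (of_real (p (int n) k) * exp (of_int k * (\<i> * of_real (\<theta> / \<sigma> n))) / of_real (?O n))"
            by (simp add: scaleR_conv_of_real)
        qed
        finally show ?thesis
          unfolding sum_distrib_left[symmetric] sum_divide_distrib[symmetric] gen_def .
      qed
      then have "eventually (\<lambda>n. char (D n) \<theta> = exp (- \<i> * of_real (\<theta> * \<mu> n / \<sigma> n)) *
            (gen (int n) (\<i> * of_real (\<theta> / \<sigma> n)) / of_real (?O n))) sequentially"
        using ev by (auto elim!: eventually_mono)
      then show "(\<lambda>n. char (D n) \<theta>) \<longlonglongrightarrow> char std_normal_distribution \<theta>"
        using moments_and_char_asymptotics(3)[OF assms(15) ev\<mu> ev\<sigma> \<sigma>_nonneg, of \<theta>]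
        by (simp only: tendsto_cong char_std_normal_distribution)
    qed
    \<comment> \<open>Weak convergence is pointwise convergence of distribution functions at
      continuity points, hence insensitive to finitely many \<open>n\<close>.\<close>
    moreover have "eventually (\<lambda>n. cdf (D n) x = cdf (?D n) x) sequentially" for x
      using ev by eventually_elim (simp add: D_def)
    ultimately show ?thesis
      unfolding weak_conv_m_def weak_conv_def using tendsto_cong by fast
  qed
  ultimately show ?thesis
    using \<gamma> by blast
qed

end
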